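(* Up to isomorphism, the connected $6$-regular strongly regular signed graphs that are $4$ net-regular (every vertex is incident with exactly $5$ positive edges and $1$ negative edge) are precisely the three signed graphs $\dot{S}^1_{12}$, $\dot{S}^2_{12}$ and $\dot{S}^3_{12}$ defined below. Their parameters $(n,r,a,b,c)$ are $(12,6,0,0,2)$, $(12,6,4,0,-2)$ and $(12,6,2,0,0)$, respectively. - $\dot{S}^1_{12}$: the vertices are $u_1,\dots,u_6,w_1,\dots,w_6$. The edges are all $u_iw_j$ with $1\le i,j\le 6$. The edge $u_iw_j$ is negative if $i=j$ and positive otherwise. There are no other edges. - $\dot{S}^2_{12}$: the vertices are $u_1,\dots,u_6,w_1,\dots,w_6$. The positive edges are $u_iu_j$ and $w_iw_j$ for all $i\ne j$, so the positive edges form two disjoint copies of $K_6$. The negative edges are $u_iw_i$ for $1\le i\le 6$. There are no other edges. - $\dot{S}^3_{12}$: the vertices are $v_1,\dots,v_{12}$. The negative edges are $v_1v_2$, $v_3v_8$, $v_4v_9$, $v_5v_{10}$, $v_6v_{11}$, $v_7v_{12}$. The positive edges are - $v_1v_k$ for $3\le k\le 7$ and $v_2v_k$ for $8\le k\le 12$; - $v_3v_4$, $v_4v_5$, $v_5v_6$, $v_6v_7$, $v_7v_3$; - $v_8v_9$, $v_9v_{10}$, $v_{10}v_{11}$, $v_{11}v_{12}$, $v_{12}v_8$; - $v_5v_8$, $v_6v_8$, $v_6v_9$, $v_7v_9$, $v_3v_{10}$, $v_7v_{10}$, $v_3v_{11}$, $v_4v_{11}$, $v_4v_{12}$, $v_5v_{12}$.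 There are no other edges.
   Context: Signed graphs. - A signed graph $\dot G=(G,\sigma)$ is a simple graph $G$ (the underlying graph) together with a sign function $\sigma:E(G)\to\{+1,-1\}$. - Its adjacency matrix $A(\dot G)$ has $(i,j)$-entry $\sigma(v_iv_j)$ if $v_i\sim v_j$ and $0$ otherwise. - Connectedness, completeness and $r$-regularity of $\dot G$ refer to $G$. - The net-degree of a vertex $v$ is $d^+(v)-d^-(v)$, where $d^{\pm}(v)$ are the numbers of positive and negative edges at $v$. $\dot G$ is $\rho$ net-regular if every vertex has net-degree $\rho$. - $\dot G$ is homogeneous if all its edges have the same sign. - Two signed graphs are isomorphic if there is an isomorphism of the underlying graphs preserving edge signs. Strongly regular signed graphs. - A signed graph $\dot G$ on $n$ vertices is a strongly regular signed graph (SRSG) if it is neither homogeneous complete nor edgeless, and there exist $r\in\mathbb N$ and $a,b,c\in\mathbb Z$ such that the $(i,j)$-entry of $A(\dot G)^2$ equals: - $r$ if $v_i=v_j$; - $a$ if $v_i$ and $v_j$ are joined by a positive edge; - $b$ if $v_i$ and $v_j$ are joined by a negative edge; - $c$ if $v_i\neq v_j$ are non-adjacent. - $(n,r,a,b,c)$ are called its parameters. *)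

theory Defs
  imports Main
begin

text \<open>
  Edges are two-element sets of vertices. The sign function is total on \<open>'v set\<close>;
  its values outside the edge set are irrelevant.
\<close>

record 'v sgraph =
  sg_verts :: "'v set"
  sg_edges :: "'v set set"
  sg_sign  :: "'v set \<Rightarrow> int"

definition signed_graph :: "'v sgraph \<Rightarrow> bool" where
  "signed_graph G \<longleftrightarrow>
     finite (sg_verts G) \<and>
     (\<forall>e\<in>sg_edges G. \<exists>u\<in>sg_verts G. \<exists>v\<in>sg_verts G. u \<noteq> v \<and> e = {u, v}) \<and>
     (\<forall>e\<in>sg_edges G. sg_sign G e = 1 \<or> sg_sign G e = -1)"

definition sg_adj_mat :: "'v sgraph \<Rightarrow> 'v \<Rightarrow> 'v \<Rightarrow> int" where
  "sg_adj_mat G u v = (if {u, v} \<in> sg_edges G then sg_sign G {u, v} else 0)"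

definition sg_adj_mat_sq :: "'v sgraph \<Rightarrow> 'v \<Rightarrow> 'v \<Rightarrow> int" where
  "sg_adj_mat_sq G u v = (\<Sum>w\<in>sg_verts G. sg_adj_mat G u w * sg_adj_mat G w v)"

definition sg_connected :: "'v sgraph \<Rightarrow> bool" where
  "sg_connected G \<longleftrightarrow>
     sg_verts G \<noteq> {} \<and>
     (\<forall>u\<in>sg_verts G. \<forall>v\<in>sg_verts G. (u, v) \<in> {(x, y). {x, y} \<in> sg_edges G}\<^sup>*)"

definition sg_complete :: "'v sgraph \<Rightarrow> bool" where
  "sg_complete G \<longleftrightarrow>
     (\<forall>u\<in>sg_verts G. \<forall>v\<in>sg_verts G. u \<noteq> v \<longrightarrow> {u, v} \<in> sg_edges G)"

definition sg_homogeneous :: "'v sgraph \<Rightarrow> bool" where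
  "sg_homogeneous G \<longleftrightarrow>
     (\<forall>e\<in>sg_edges G. \<forall>f\<in>sg_edges G. sg_sign G e = sg_sign G f)"

definition sg_degree :: "'v sgraph \<Rightarrow> 'v \<Rightarrow> nat" where
  "sg_degree G v = card {e \<in> sg_edges G. v \<in> e}"

definition sg_pos_degree :: "'v sgraph \<Rightarrow> 'v \<Rightarrow> nat" where
  "sg_pos_degree G v = card {e \<in> sg_edges G. v \<in> e \<and> sg_sign G e = 1}"

definition sg_neg_degree :: "'v sgraph \<Rightarrow> 'v \<Rightarrow> nat" where
  "sg_neg_degree G v = card {e \<in> sg_edges G. v \<in> e \<and> sg_sign G e = -1}"

definition sg_regular :: "'v sgraph \<Rightarrow> nat \<Rightarrow> bool" where
  "sg_regular G r \<longleftrightarrow> (\<forall>v\<in>sg_verts G. sg_degree G v = r)"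

definition sg_net_regular :: "'v sgraph \<Rightarrow> int \<Rightarrow> bool" where
  "sg_net_regular G \<rho> \<longleftrightarrow>
     (\<forall>v\<in>sg_verts G. int (sg_pos_degree G v) - int (sg_neg_degree G v) = \<rho>)"

definition srsg_params :: "'v sgraph \<Rightarrow> nat \<Rightarrow> nat \<Rightarrow> int \<Rightarrow> int \<Rightarrow> int \<Rightarrow> bool" where
  "srsg_params G n r a b c \<longleftrightarrow>
     signed_graph G \<and> card (sg_verts G) = n \<and>
     \<not> (sg_homogeneous G \<and> sg_complete G) \<and> sg_edges G \<noteq> {} \<and>
     (\<forall>u\<in>sg_verts G. \<forall>v\<in>sg_verts G.
        (u = v \<longrightarrow> sg_adj_mat_sq G u v = int r) \<and>
        ({u, v} \<in> sg_edges G \<and> sg_sign G {u, v} = 1 \<longrightarrow> sg_adj_mat_sq G u v = a) \<and>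
        ({u, v} \<in> sg_edges G \<and> sg_sign G {u, v} = -1 \<longrightarrow> sg_adj_mat_sq G u v = b) \<and>
        (u \<noteq> v \<and> {u, v} \<notin> sg_edges G \<longrightarrow> sg_adj_mat_sq G u v = c))"

definition srsg :: "'v sgraph \<Rightarrow> bool" where
  "srsg G \<longleftrightarrow> (\<exists>n r a b c. srsg_params G n r a b c)"

definition sg_iso :: "'v sgraph \<Rightarrow> 'w sgraph \<Rightarrow> bool" where
  "sg_iso G H \<longleftrightarrow>
     (\<exists>f. bij_betw f (sg_verts G) (sg_verts H) \<and>
       (\<forall>u\<in>sg_verts G. \<forall>v\<in>sg_verts G.
          ({u, v} \<in> sg_edges G \<longleftrightarrow> {f u, f v} \<in> sg_edges H) \<and>
          ({u, v} \<in> sg_edges G \<longrightarrow> sg_sign H {f u, f v} = sg_sign G {u, v})))"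

definition sg_make :: "'v set \<Rightarrow> 'v set set \<Rightarrow> 'v set set \<Rightarrow> 'v sgraph" where
  "sg_make V P N =
     \<lparr>sg_verts = V, sg_edges = P \<union> N, sg_sign = (\<lambda>e. if e \<in> N then -1 else 1)\<rparr>"

datatype uw = U nat | W nat

definition S12_1 :: "uw sgraph" where
  "S12_1 = sg_make (U ` {1..6} \<union> W ` {1..6})
     {{U i, W j} | i j. i \<in> {1..6} \<and> j \<in> {1..6} \<and> i \<noteq> j}
     {{U i, W i} | i. i \<in> {1..6}}"

definition S12_2 :: "uw sgraph" where
  "S12_2 = sg_make (U ` {1..6} \<union> W ` {1..6})
     ({{U i, U j} | i j. i \<in> {1..6} \<and> j \<in> {1..6} \<and> i \<noteq> j} \<union>
      {{W i, W j} | i j. i \<in> {1..6} \<and> j \<in> {1..6} \<and> i \<noteq> j})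
     {{U i, W i} | i. i \<in> {1..6}}"

definition S12_3 :: "nat sgraph" where
  "S12_3 = sg_make {1..12}
     ({{1, k} | k. k \<in> {3..7}} \<union> {{2, k} | k. k \<in> {8..12}} \<union>
      {{3, 4}, {4, 5}, {5, 6}, {6, 7}, {7, 3}} \<union>
      {{8, 9}, {9, 10}, {10, 11}, {11, 12}, {12, 8}} \<union>
      {{5, 8}, {6, 8}, {6, 9}, {7, 9}, {3, 10}, {7, 10}, {3, 11}, {4, 11}, {4, 12}, {5, 12}})
     {{1, 2}, {3, 8}, {4, 9}, {5, 10}, {6, 11}, {7, 12}}"

end

theory Submission
  imports Defs
begin

text \<open>
  Let \<open>P\<close> be the graph of positive edges and \<open>m\<close> the involution exchanging the ends of every negative
  edge, with matrix \<open>M\<close>. Then \<open>A\<^sup>2 = (6 - c) I + (a - c) A + (a + b - 2 c) M + c J\<close>. The coefficient of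
  \<open>M\<close> does not vanish, so \<open>M\<close> commutes with \<open>A\<close>, that is, \<open>m\<close> is an automorphism of \<open>P\<close>. Counting common
  neighbours, together with the handshake lemma inside a neighbourhood of \<open>P\<close>, yields \<open>b = 0\<close> and
  \<open>a \<in> {0, 2, 4}\<close>, so every neighbourhood of \<open>P\<close> induces an \<open>a\<close>-regular graph on five vertices. For
  \<open>a = 0\<close> the signed graph is \<open>K\<^bsub>6,6\<^esub>\<close> with a negative perfect matching, for \<open>a = 4\<close> it consists of two
  copies of \<open>K\<^sub>6\<close> joined by a negative matching, and for \<open>a = 2\<close> the graph \<open>P\<close> is locally a pentagon,
  hence the icosahedron, and \<open>m\<close> is its antipodal map.
\<close>

section \<open>Signed graphs and their adjacency matrices\<close>

definition pos_adj :: "'v sgraph \<Rightarrow> 'v \<Rightarrow> 'v \<Rightarrow> bool" where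
  "pos_adj G u v \<longleftrightarrow> {u, v} \<in> sg_edges G \<and> sg_sign G {u, v} = 1"

definition neg_adj :: "'v sgraph \<Rightarrow> 'v \<Rightarrow> 'v \<Rightarrow> bool" where
  "neg_adj G u v \<longleftrightarrow> {u, v} \<in> sg_edges G \<and> sg_sign G {u, v} = -1"

lemma pos_adj_commute: "pos_adj G u v \<longleftrightarrow> pos_adj G v u"
  by (simp add: pos_adj_def insert_commute)

lemma neg_adj_commute: "neg_adj G u v \<longleftrightarrow> neg_adj G v u"
  by (simp add: neg_adj_def insert_commute)

lemma not_pos_neg_adj: "\<not> (pos_adj G u v \<and> neg_adj G u v)"
  by (simp add: pos_adj_def neg_adj_def)

lemma edge_iff_pos_or_neg:
  "signed_graph G \<Longrightarrow> {u, v} \<in> sg_edges G \<longleftrightarrow> pos_adj G u v \<or> neg_adj G u v"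
  by (auto simp: signed_graph_def pos_adj_def neg_adj_def)

lemma edge_in_verts:
  "signed_graph G \<Longrightarrow> {u, v} \<in> sg_edges G \<Longrightarrow> u \<in> sg_verts G \<and> v \<in> sg_verts G \<and> u \<noteq> v"
  by (fastforce simp: signed_graph_def doubleton_eq_iff)

lemma pos_adj_in_verts:
  "signed_graph G \<Longrightarrow> pos_adj G u v \<Longrightarrow> u \<in> sg_verts G \<and> v \<in> sg_verts G \<and> u \<noteq> v"
  by (meson edge_in_verts pos_adj_def)

lemma neg_adj_in_verts:
  "signed_graph G \<Longrightarrow> neg_adj G u v \<Longrightarrow> u \<in> sg_verts G \<and> v \<in> sg_verts G \<and> u \<noteq> v"
  by (meson edge_in_verts neg_adj_def)

lemma sg_adj_mat_eq:
  "signed_graph G \<Longrightarrow> sg_adj_mat G u v = of_bool (pos_adj G u v) - of_bool (neg_adj G u v)"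
  by (auto simp: sg_adj_mat_def signed_graph_def pos_adj_def neg_adj_def)

text \<open>The map sending \<open>u\<close> to \<open>{v, u}\<close> is a bijection from the
  neighbours of \<open>v\<close> to the edges at \<open>v\<close>. The free predicate
  \<open>Q\<close> lets one lemma serve all three degrees.\<close>

lemma card_incident_edges:
  assumes "signed_graph G" "v \<in> sg_verts G"
  shows "card {e \<in> sg_edges G. v \<in> e \<and> Q e} = card {u \<in> sg_verts G. {v, u} \<in> sg_edges G \<and> Q {v, u}}"
proof -
  have "bij_betw (\<lambda>u. {v, u}) {u \<in> sg_verts G. {v, u} \<in> sg_edges G \<and> Q {v, u}}
          {e \<in> sg_edges G. v \<in> e \<and> Q e}"
  proof (rule bij_betw_imageI)
    show "inj_on (\<lambda>u. {v, u}) {u \<in> sg_verts G. {v, u} \<in> sg_edges G \<and> Q {v, u}}"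
      by (auto simp: inj_on_def doubleton_eq_iff)
    have "e \<in> (\<lambda>u. {v, u}) ` {u \<in> sg_verts G. {v, u} \<in> sg_edges G \<and> Q {v, u}}"
      if e: "e \<in> sg_edges G" "v \<in> e" "Q e" for e
    proof -
      obtain x y where "x \<in> sg_verts G" "y \<in> sg_verts G" "e = {x, y}"
        using assms(1) e(1) unfolding signed_graph_def by meson
      then obtain u where "u \<in> sg_verts G" "e = {v, u}"
        using e(2) by auto
      then show ?thesis using e by auto
    qed
    then show "(\<lambda>u. {v, u}) ` {u \<in> sg_verts G. {v, u} \<in> sg_edges G \<and> Q {v, u}} =
        {e \<in> sg_edges G. v \<in> e \<and> Q e}"
      by auto
  qed
  then show ?thesis by (simp add: bij_betw_same_card)
qed

lemma sg_pos_degree_eq: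
  "signed_graph G \<Longrightarrow> v \<in> sg_verts G \<Longrightarrow> sg_pos_degree G v = card {u \<in> sg_verts G. pos_adj G v u}"
  unfolding sg_pos_degree_def pos_adj_def by (rule card_incident_edges)

lemma sg_neg_degree_eq:
  "signed_graph G \<Longrightarrow> v \<in> sg_verts G \<Longrightarrow> sg_neg_degree G v = card {u \<in> sg_verts G. neg_adj G v u}"
  unfolding sg_neg_degree_def neg_adj_def by (rule card_incident_edges)

lemma sg_degree_eq:
  assumes "signed_graph G" "v \<in> sg_verts G"
  shows "sg_degree G v = sg_pos_degree G v + sg_neg_degree G v"
proof -
  have "sg_degree G v = card {u \<in> sg_verts G. {v, u} \<in> sg_edges G}"
    using card_incident_edges[OF assms, of "\<lambda>_. True"] by (simp add: sg_degree_def)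
  also have "{u \<in> sg_verts G. {v, u} \<in> sg_edges G} =
      {u \<in> sg_verts G. pos_adj G v u} \<union> {u \<in> sg_verts G. neg_adj G v u}"
    using edge_iff_pos_or_neg[OF assms(1)] by auto
  also have "card \<dots> = card {u \<in> sg_verts G. pos_adj G v u} + card {u \<in> sg_verts G. neg_adj G v u}"
    using assms(1) not_pos_neg_adj[of G] by (intro card_Un_disjoint) (auto simp: signed_graph_def)
  finally show ?thesis using assms by (simp add: sg_pos_degree_eq sg_neg_degree_eq)
qed

lemma pos5_neg1_iff:
  assumes "signed_graph G"
  shows "sg_regular G 6 \<and> sg_net_regular G 4 \<longleftrightarrow>
    (\<forall>v\<in>sg_verts G. card {u \<in> sg_verts G. pos_adj G v u} = 5 \<and>
                    card {u \<in> sg_verts G. neg_adj G v u} = 1)"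
proof -
  have "sg_degree G v = 6 \<and> int (sg_pos_degree G v) - int (sg_neg_degree G v) = 4 \<longleftrightarrow>
      card {u \<in> sg_verts G. pos_adj G v u} = 5 \<and> card {u \<in> sg_verts G. neg_adj G v u} = 1"
    if "v \<in> sg_verts G" for v
    unfolding sg_degree_eq[OF assms that] sg_pos_degree_eq[OF assms that]
      sg_neg_degree_eq[OF assms that] by linarith
  then show ?thesis
    unfolding sg_regular_def sg_net_regular_def by blast
qed

text \<open>The four conditions on a pair are exclusive and exhaustive in a signed graph, so they
  merge into one equation with a nested conditional.\<close>

lemma srsg_params_iff:
  assumes "signed_graph G"
  shows "srsg_params G n r a b c \<longleftrightarrow>
     card (sg_verts G) = n \<and> \<not> (sg_homogeneous G \<and> sg_complete G) \<and> sg_edges G \<noteq> {} \<and>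
     (\<forall>u\<in>sg_verts G. \<forall>v\<in>sg_verts G. sg_adj_mat_sq G u v =
        (if u = v then int r else if pos_adj G u v then a else if neg_adj G u v then b else c))"
proof -
  have *: "(u = v \<longrightarrow> x = int r) \<and>
        ({u, v} \<in> sg_edges G \<and> sg_sign G {u, v} = 1 \<longrightarrow> x = a) \<and>
        ({u, v} \<in> sg_edges G \<and> sg_sign G {u, v} = -1 \<longrightarrow> x = b) \<and>
        (u \<noteq> v \<and> {u, v} \<notin> sg_edges G \<longrightarrow> x = c) \<longleftrightarrow>
      x = (if u = v then int r else if pos_adj G u v then a else if neg_adj G u v then b else c)"
    for u v x
    using edge_iff_pos_or_neg[OF assms, of u v] pos_adj_in_verts[OF assms, of u v]
      neg_adj_in_verts[OF assms, of u v] not_pos_neg_adj[of G u v]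
    unfolding pos_adj_def[symmetric] neg_adj_def[symmetric] by auto
  show ?thesis unfolding srsg_params_def * using assms by simp
qed

lemma not_homogeneous_if_pos_neg:
  "pos_adj G u v \<Longrightarrow> neg_adj G x y \<Longrightarrow> \<not> sg_homogeneous G"
  by (fastforce simp: sg_homogeneous_def pos_adj_def neg_adj_def)

lemma pos_adj_iff: "signed_graph G \<Longrightarrow> pos_adj G u v \<longleftrightarrow> sg_adj_mat G u v = 1"
  using not_pos_neg_adj[of G u v] by (simp add: sg_adj_mat_eq)

lemma neg_adj_iff: "signed_graph G \<Longrightarrow> neg_adj G u v \<longleftrightarrow> sg_adj_mat G u v = -1"
  using not_pos_neg_adj[of G u v] by (simp add: sg_adj_mat_eq)

lemma edge_iff: "signed_graph G \<Longrightarrow> {u, v} \<in> sg_edges G \<longleftrightarrow> sg_adj_mat G u v \<noteq> 0"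
  by (auto simp: sg_adj_mat_def signed_graph_def)

section \<open>Isomorphisms of signed graphs and their invariants\<close>

lemma sg_isoI:
  assumes "signed_graph G" "signed_graph H" "bij_betw f (sg_verts G) (sg_verts H)"
    and adj: "\<And>u v. u \<in> sg_verts G \<Longrightarrow> v \<in> sg_verts G \<Longrightarrow>
      sg_adj_mat H (f u) (f v) = sg_adj_mat G u v"
  shows "sg_iso G H"
  unfolding sg_iso_def
proof (intro exI[of _ f] conjI ballI)
  fix u v assume uv: "u \<in> sg_verts G" "v \<in> sg_verts G"
  show e: "{u, v} \<in> sg_edges G \<longleftrightarrow> {f u, f v} \<in> sg_edges H"
    unfolding edge_iff[OF assms(1)] edge_iff[OF assms(2)] adj[OF uv] ..
  show "{u, v} \<in> sg_edges G \<longrightarrow> sg_sign H {f u, f v} = sg_sign G {u, v}"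
    using adj[OF uv] e unfolding sg_adj_mat_def by metis
qed fact

lemma sg_isoD:
  assumes "sg_iso G H"
  shows "\<exists>f. bij_betw f (sg_verts G) (sg_verts H) \<and>
    (\<forall>u\<in>sg_verts G. \<forall>v\<in>sg_verts G. pos_adj H (f u) (f v) \<longleftrightarrow> pos_adj G u v) \<and>
    (\<forall>u\<in>sg_verts G. \<forall>v\<in>sg_verts G. neg_adj H (f u) (f v) \<longleftrightarrow> neg_adj G u v)"
  using assms unfolding sg_iso_def pos_adj_def neg_adj_def by (elim ex_forward) auto

lemma sg_iso_sym:
  assumes "sg_iso G H" "signed_graph G" "signed_graph H"
  shows "sg_iso H G"
proof -
  obtain f where f: "bij_betw f (sg_verts G) (sg_verts H)"
    and p: "\<forall>u\<in>sg_verts G. \<forall>v\<in>sg_verts G. pos_adj H (f u) (f v) \<longleftrightarrow> pos_adj G u v"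
    and n: "\<forall>u\<in>sg_verts G. \<forall>v\<in>sg_verts G. neg_adj H (f u) (f v) \<longleftrightarrow> neg_adj G u v"
    using sg_isoD[OF assms(1)] by blast
  note pn = p[rule_format] n[rule_format]
  let ?g = "inv_into (sg_verts G) f"
  have g: "?g x \<in> sg_verts G" "f (?g x) = x" if "x \<in> sg_verts H" for x
    using f that by (auto simp: bij_betw_def inv_into_into f_inv_into_f)
  show ?thesis
    by (rule sg_isoI[of _ _ ?g])
       (use assms f g pn bij_betw_inv_into in \<open>auto simp: sg_adj_mat_eq simp flip: pn\<close>)
qed

lemma card_Collect_bij_betw:
  assumes "bij_betw f X Y" "\<And>u. u \<in> X \<Longrightarrow> Q (f u) \<longleftrightarrow> R u"
  shows "card {u \<in> Y. Q u} = card {u \<in> X. R u}"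
proof -
  have "bij_betw f {u \<in> X. R u} {u \<in> Y. Q u}"
    using assms by (fastforce simp: bij_betw_def inj_on_def)
  then show ?thesis by (simp add: bij_betw_same_card)
qed

lemma sg_iso_regularity:
  assumes "sg_iso G H" "signed_graph G" "signed_graph H" "sg_regular H 6 \<and> sg_net_regular H 4"
  shows "sg_regular G 6 \<and> sg_net_regular G 4"
proof -
  obtain f where f: "bij_betw f (sg_verts G) (sg_verts H)"
    and p: "\<forall>u\<in>sg_verts G. \<forall>v\<in>sg_verts G. pos_adj H (f u) (f v) \<longleftrightarrow> pos_adj G u v"
    and n: "\<forall>u\<in>sg_verts G. \<forall>v\<in>sg_verts G. neg_adj H (f u) (f v) \<longleftrightarrow> neg_adj G u v"
    using sg_isoD[OF assms(1)] by blast
  note pn = p[rule_format] n[rule_format]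
  have H: "card {u \<in> sg_verts H. pos_adj H v u} = 5 \<and> card {u \<in> sg_verts H. neg_adj H v u} = 1"
    if "v \<in> sg_verts H" for v
    using that assms(4) pos5_neg1_iff[OF assms(3)] by blast
  show ?thesis
    unfolding pos5_neg1_iff[OF assms(2)]
  proof
    fix v assume v: "v \<in> sg_verts G"
    then have "f v \<in> sg_verts H" using f by (auto simp: bij_betw_def)
    then show "card {u \<in> sg_verts G. pos_adj G v u} = 5 \<and> card {u \<in> sg_verts G. neg_adj G v u} = 1"
      using card_Collect_bij_betw[OF f, of "pos_adj H (f v)" "pos_adj G v"]
        card_Collect_bij_betw[OF f, of "neg_adj H (f v)" "neg_adj G v"] pn v H by simp
  qed
qed

lemma sg_iso_connected:
  assumes "sg_iso G H" "signed_graph G" "signed_graph H" "sg_connected H"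
  shows "sg_connected G"
proof -
  obtain g where g: "bij_betw g (sg_verts H) (sg_verts G)"
    and e: "\<forall>u\<in>sg_verts H. \<forall>v\<in>sg_verts H. {u, v} \<in> sg_edges H \<longleftrightarrow> {g u, g v} \<in> sg_edges G"
    using sg_iso_sym[OF assms(1-3)] unfolding sg_iso_def by blast
  have *: "(g u, g v) \<in> {(x, y). {x, y} \<in> sg_edges G}\<^sup>*"
    if "(u, v) \<in> {(x, y). {x, y} \<in> sg_edges H}\<^sup>*" for u v
    using that
  proof induction
    case (step y z)
    have "(g y, g z) \<in> {(x, y). {x, y} \<in> sg_edges G}"
      using step(2) e edge_in_verts[OF assms(3), of y z] by simp
    then show ?case by (rule rtrancl_into_rtrancl[OF step.IH])
  qed simp
  have "sg_verts G = g ` sg_verts H"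
    using g by (simp add: bij_betw_def)
  with assms(4) * show ?thesis
    unfolding sg_connected_def by auto
qed

text \<open>Entries of the square are transported by reindexing the sum along \<open>f\<close>.
  Completeness and homogeneity pass from \<open>G\<close> to \<open>H\<close> because
  \<open>f\<close> is onto, so \<open>G\<close> cannot be homogeneous complete when \<open>H\<close>
  is not.\<close>

lemma sg_iso_srsg_params:
  assumes "sg_iso G H" "signed_graph G" "signed_graph H" "srsg_params H n r a b c"
  shows "srsg_params G n r a b c"
proof -
  obtain f where f: "bij_betw f (sg_verts G) (sg_verts H)"
    and p': "\<forall>u\<in>sg_verts G. \<forall>v\<in>sg_verts G. pos_adj H (f u) (f v) \<longleftrightarrow> pos_adj G u v"
    and n': "\<forall>u\<in>sg_verts G. \<forall>v\<in>sg_verts G. neg_adj H (f u) (f v) \<longleftrightarrow> neg_adj G u v"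
    using sg_isoD[OF assms(1)] by blast
  note p = p'[rule_format] and n = n'[rule_format]
  have fV: "f u \<in> sg_verts H" if "u \<in> sg_verts G" for u
    using that f by (auto simp: bij_betw_def)
  have surj: "\<exists>u\<in>sg_verts G. x = f u" if "x \<in> sg_verts H" for x
    using that f by (auto simp: bij_betw_def)
  have inj: "f u = f v \<longleftrightarrow> u = v" if "u \<in> sg_verts G" "v \<in> sg_verts G" for u v
    using that f by (auto simp: bij_betw_def inj_on_def)
  have H: "card (sg_verts H) = n" "\<not> (sg_homogeneous H \<and> sg_complete H)" "sg_edges H \<noteq> {}"
    and sq: "\<And>u v. u \<in> sg_verts H \<Longrightarrow> v \<in> sg_verts H \<Longrightarrow> sg_adj_mat_sq H u v =
        (if u = v then int r else if pos_adj H u v then a else if neg_adj H u v then b else c)"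
    using assms(4) unfolding srsg_params_iff[OF assms(3)] by blast+
  have edge: "{f u, f v} \<in> sg_edges H \<longleftrightarrow> {u, v} \<in> sg_edges G"
    if "u \<in> sg_verts G" "v \<in> sg_verts G" for u v
    using that p n assms(2,3) by (simp add: edge_iff_pos_or_neg)
  have sign: "sg_sign H {f u, f v} = sg_sign G {u, v}" if "{u, v} \<in> sg_edges G" for u v
    using that p[of u v] n[of u v] edge[of u v] edge_in_verts[OF assms(2) that] assms(2)
    by (metis edge_iff_pos_or_neg neg_adj_def pos_adj_def)
  have "sg_complete H" if "sg_complete G"
    unfolding sg_complete_def
  proof (intro ballI impI)
    fix x y assume xy: "x \<in> sg_verts H" "y \<in> sg_verts H" "x \<noteq> y"
    then obtain u v where "u \<in> sg_verts G" "v \<in> sg_verts G" "x = f u" "y = f v"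
      using surj[of x] surj[of y] by blast
    then show "{x, y} \<in> sg_edges H"
      using that edge[of u v] xy(3) unfolding sg_complete_def by metis
  qed
  moreover have "sg_homogeneous H" if "sg_homogeneous G"
    unfolding sg_homogeneous_def
  proof (intro ballI)
    have *: "\<exists>e'\<in>sg_edges G. sg_sign H e = sg_sign G e'" if e: "e \<in> sg_edges H" for e
    proof -
      obtain x y where "x \<in> sg_verts H" "y \<in> sg_verts H" "e = {x, y}"
        using e assms(3) unfolding signed_graph_def by meson
      then obtain u v where "u \<in> sg_verts G" "v \<in> sg_verts G" "e = {f u, f v}"
        using surj by metis
      then show ?thesis using edge sign e by blast
    qed
    fix e e' assume "e \<in> sg_edges H" "e' \<in> sg_edges H"
    then show "sg_sign H e = sg_sign H e'"
      using * that unfolding sg_homogeneous_def by metis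
  qed
  moreover have "sg_edges G \<noteq> {}"
  proof -
    obtain e where "e \<in> sg_edges H" using H(3) by blast
    then obtain x y where xy: "x \<in> sg_verts H" "y \<in> sg_verts H" "{x, y} \<in> sg_edges H"
      using assms(3) unfolding signed_graph_def by metis
    obtain u v where "u \<in> sg_verts G" "v \<in> sg_verts G" "x = f u" "y = f v"
      using surj[OF xy(1)] surj[OF xy(2)] by metis
    then have "{u, v} \<in> sg_edges G" using edge[of u v] xy(3) by simp
    then show ?thesis by auto
  qed
  moreover have "sg_adj_mat_sq G u v = sg_adj_mat_sq H (f u) (f v)"
    if "u \<in> sg_verts G" "v \<in> sg_verts G" for u v
  proof -
    have "sg_adj_mat_sq H (f u) (f v) =
        (\<Sum>w\<in>sg_verts G. sg_adj_mat H (f u) (f w) * sg_adj_mat H (f w) (f v))"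
      unfolding sg_adj_mat_sq_def by (rule sum.reindex_bij_betw[OF f, symmetric])
    also have "\<dots> = sg_adj_mat_sq G u v"
      unfolding sg_adj_mat_sq_def using that p n assms(2,3)
      by (intro sum.cong) (simp_all add: sg_adj_mat_eq)
    finally show ?thesis by simp
  qed
  moreover have "card (sg_verts G) = n"
    using f H(1) by (simp add: bij_betw_same_card)
  ultimately show ?thesis
    unfolding srsg_params_iff[OF assms(2)] using H(2) sq fV inj p n by (simp, blast)
qed

text \<open>One positive edge determines \<open>a\<close>; this makes \<open>a\<close> an invariant
  that can separate the three graphs.\<close>

lemma srsg_params_pos_unique:
  assumes "srsg_params G n r a b c" "srsg_params G n' r' a' b' c'" "pos_adj G u v"
  shows "a = a'"
proof -
  have G: "signed_graph G" using assms(1) by (simp add: srsg_params_def)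
  have uv: "u \<in> sg_verts G" "v \<in> sg_verts G"
    using pos_adj_in_verts[OF G assms(3)] by blast+
  have "sg_adj_mat_sq G u v = a"
    using uv assms(1,3) unfolding srsg_params_def pos_adj_def by blast
  moreover have "sg_adj_mat_sq G u v = a'"
    using uv assms(2,3) unfolding srsg_params_def pos_adj_def by blast
  ultimately show ?thesis by simp
qed

section \<open>Counting\<close>

text \<open>The orbits \<open>{x, f x}\<close> partition \<open>S\<close> into blocks of size
  two.\<close>

lemma even_card_involution:
  assumes "finite S" "\<And>x. x \<in> S \<Longrightarrow> f x \<in> S \<and> f (f x) = x \<and> f x \<noteq> x"
  shows "even (card S)"
proof -
  let ?orb = "\<lambda>x. {x, f x}"
  have orb: "?orb z = ?orb x" if "x \<in> S" "z \<in> ?orb x" for x z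
  proof -
    have "f (f x) = x" using assms(2) that(1) by blast
    with that(2) show ?thesis by (elim insertE emptyE) (simp_all add: insert_commute)
  qed
  have "2 * card (?orb ` S) = card (\<Union>(?orb ` S))"
  proof (rule card_partition)
    show "card C = 2" if "C \<in> ?orb ` S" for C
      using that assms(2) by (fastforce simp: card_insert_if)
    show "C \<inter> D = {}" if CD: "C \<in> ?orb ` S" "D \<in> ?orb ` S" "C \<noteq> D" for C D
    proof (rule ccontr)
      assume "C \<inter> D \<noteq> {}"
      then obtain z where z: "z \<in> C" "z \<in> D" by blast
      obtain x y where xy: "x \<in> S" "y \<in> S" "C = ?orb x" "D = ?orb y"
        using CD(1,2) by blast
      have "?orb z = ?orb x" by (rule orb) (use xy z in blast)+
      moreover have "?orb z = ?orb y" by (rule orb) (use xy z in blast)+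
      ultimately show False using CD(3) xy(3,4) by (simp only:)
    qed
  qed (use assms(1) in auto)
  moreover have "\<Union>(?orb ` S) = S" using assms(2) by auto
  ultimately show ?thesis by (metis dvd_triv_left)
qed

text \<open>The orbits have exactly three elements: \<open>f (f x) = x\<close> would give
  \<open>f x = f (f (f x)) = x\<close>.\<close>

lemma three_dvd_card_rotation:
  assumes "finite S" "\<And>x. x \<in> S \<Longrightarrow> f x \<in> S \<and> f (f (f x)) = x \<and> f x \<noteq> x"
  shows "3 dvd card S"
proof -
  let ?orb = "\<lambda>x. {x, f x, f (f x)}"
  have orb: "?orb z = ?orb x" if "x \<in> S" "z \<in> ?orb x" for x z
  proof -
    have "f (f (f x)) = x" using assms(2) that(1) by blast
    with that(2) show ?thesis by (elim insertE emptyE) (simp_all add: insert_commute)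
  qed
  have "3 * card (?orb ` S) = card (\<Union>(?orb ` S))"
  proof (rule card_partition)
    show "card C = 3" if C: "C \<in> ?orb ` S" for C
    proof -
      obtain x where x: "x \<in> S" "C = ?orb x" using C by blast
      then show ?thesis using assms(2)[of x] assms(2)[of "f x"] by (auto simp: card_insert_if)
    qed
    show "C \<inter> D = {}" if CD: "C \<in> ?orb ` S" "D \<in> ?orb ` S" "C \<noteq> D" for C D
    proof (rule ccontr)
      assume "C \<inter> D \<noteq> {}"
      then obtain z where z: "z \<in> C" "z \<in> D" by blast
      obtain x y where xy: "x \<in> S" "y \<in> S" "C = ?orb x" "D = ?orb y"
        using CD(1,2) by blast
      have "?orb z = ?orb x" by (rule orb) (use xy z in blast)+
      moreover have "?orb z = ?orb y" by (rule orb) (use xy z in blast)+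
      ultimately show False using CD(3) xy(3,4) by (simp only:)
    qed
  qed (use assms(1) in auto)
  moreover have "\<Union>(?orb ` S) = S" using assms(2) by auto
  ultimately show ?thesis by (metis dvd_triv_left)
qed

text \<open>Handshake lemma: swapping the ends is a fixed-point-free involution on the ordered
  edges.\<close>

lemma even_sum_card_nbrs:
  assumes "finite S" "\<And>x y. x \<in> S \<Longrightarrow> y \<in> D x \<Longrightarrow> y \<in> S \<and> x \<in> D y \<and> x \<noteq> y"
  shows "even (\<Sum>x\<in>S. card (D x))"
proof -
  have fin: "\<forall>x\<in>S. finite (D x)" using assms by (meson finite_subset subsetI)
  have "even (card (Sigma S D))"
  proof (rule even_card_involution[where f = prod.swap])
    show "finite (Sigma S D)" using assms(1) fin by (intro finite_SigmaI) auto
    fix e assume "e \<in> Sigma S D"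
    then obtain x y where "e = (x, y)" "x \<in> S" "y \<in> D x" by blast
    with assms(2)[OF this(2,3)]
    show "prod.swap e \<in> Sigma S D \<and> prod.swap (prod.swap e) = e \<and> prod.swap e \<noteq> e"
      by simp
  qed
  then show ?thesis using assms(1) fin by simp
qed

text \<open>A 2-regular graph on five vertices is a pentagon: a shorter cycle would leave at most
  two vertices, too few to have degree two among themselves. The cycle is read off as x, y, p, q,
  z.\<close>

lemma two_regular_on_five:
  assumes card: "card S = 5"
    and D: "\<And>x y. x \<in> S \<Longrightarrow> y \<in> D x \<Longrightarrow> y \<in> S \<and> x \<in> D y \<and> x \<noteq> y"
    and deg: "\<And>x. x \<in> S \<Longrightarrow> card (D x) = 2"
  obtains x y p q z where "S = {x, y, p, q, z}" "distinct [x, y, p, q, z]"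
    "D x = {z, y}" "D y = {x, p}" "D p = {y, q}" "D q = {p, z}" "D z = {q, x}"
proof -
  have fin: "finite S" using card by (metis card.infinite zero_neq_numeral)
  have other: "\<exists>v. v \<noteq> w \<and> D u = {w, v} \<and> v \<in> S \<and> v \<noteq> u \<and> u \<in> D v"
    if u: "u \<in> S" and w: "w \<in> D u" for u w
  proof -
    obtain s t where st: "D u = {s, t}" "s \<noteq> t"
      using deg[OF u] unfolding card_2_iff by blast
    have "w = s \<or> w = t" using w st by simp
    then obtain v where v: "D u = {w, v}" "v \<noteq> w"
      using st by (metis insert_commute)
    then have "v \<in> D u" by simp
    with v show ?thesis using D[OF u] by fast
  qed
  \<comment> \<open>By symmetry a vertex outside a closed \<open>T\<close> has all its neighbours
    outside \<open>T\<close>, where at most one other vertex is left.\<close>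
  have no_closed: "T = S" if T: "T \<subseteq> S" "3 \<le> card T" and cl: "\<forall>t\<in>T. D t \<subseteq> T" for T
  proof (rule ccontr)
    assume "T \<noteq> S"
    then obtain s where s: "s \<in> S" "s \<notin> T" using T by blast
    have "D s \<subseteq> S - insert s T"
      using D[OF s(1)] cl s by blast
    then have "card (D s) \<le> card (S - insert s T)"
      using fin by (intro card_mono) auto
    moreover have "card (S - insert s T) = 5 - Suc (card T)"
      using fin T s card finite_subset[OF T(1) fin] by (subst card_Diff_subset) auto
    ultimately show False using deg[OF s(1)] T(2) by simp
  qed
  obtain x where x: "x \<in> S" using card by (metis card.empty equals0I zero_neq_numeral)
  obtain y where "y \<in> D x" using deg[OF x] by (metis card.empty equals0I zero_neq_numeral)
  then have y: "y \<in> S" "x \<in> D y" "x \<noteq> y" using D[OF x \<open>y \<in> D x\<close>] by simp_all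
  obtain z where z: "z \<noteq> y" "D x = {y, z}" "z \<in> S" "z \<noteq> x" "x \<in> D z"
    using other[OF x \<open>y \<in> D x\<close>] by blast
  obtain p where p: "p \<noteq> x" "D y = {x, p}" "p \<in> S" "p \<noteq> y" "y \<in> D p"
    using other[OF y(1,2)] by blast
  obtain q where q: "q \<noteq> x" "D z = {x, q}" "q \<in> S" "q \<noteq> z" "z \<in> D q"
    using other[OF z(3,5)] by blast
  \<comment> \<open>Equality would close a triangle on x, y, z.\<close>
  have pz: "p \<noteq> z"
  proof
    assume "p = z"
    then have "q = y" using p(5) q(2) y(3) by auto
    have "card {x, y, z} = 3" using y z by auto
    moreover have "{x, y, z} = S"
      using x y(1) z(2,3) p(2) q(2) \<open>p = z\<close> \<open>q = y\<close> calculation by (intro no_closed) auto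
    ultimately show False using card by simp
  qed
  have qy: "q \<noteq> y" using q(5) p(2) z(4) pz by auto
  \<comment> \<open>Equality would close a 4-cycle on x, y, z, p.\<close>
  have pq: "p \<noteq> q"
  proof
    assume "p = q"
    obtain v where "v \<noteq> y" "D p = {y, v}" using other[OF p(3,5)] by blast
    then have Dp: "D p = {y, z}" using q(5) z(1) \<open>p = q\<close> by auto
    have "card {x, y, z, p} = 4" using y z p pz by auto
    moreover have "{x, y, z, p} = S"
      using x y(1) z(2,3) p(2,3) q(2) \<open>p = q\<close> Dp calculation by (intro no_closed) auto
    ultimately show False using card by simp
  qed
  have "card {x, y, p, q, z} = 5" using y z p q pz qy pq by auto
  then have S: "S = {x, y, p, q, z}"
    using card fin x y(1) z(3) p(3) q(3) by (intro card_subset_eq[symmetric]) auto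
  obtain v where v: "v \<noteq> y" "D p = {y, v}" "v \<in> S" "v \<noteq> p" "p \<in> D v"
    using other[OF p(3,5)] by blast
  have "v \<noteq> x" using v(5) z(2) p(4) pz by auto
  moreover have "v \<noteq> z" using v(5) q(2) p(1) pq by auto
  ultimately have "v = q" using v(1,3,4) S by auto
  then have qp: "p \<in> D q" using v(5) by simp
  obtain u where u: "u \<noteq> p" "D q = {p, u}"
    using other[OF q(3) qp] by blast
  then have "u = z" using q(5) pz by auto
  with u have Dq: "D q = {p, z}" by simp
  have dist: "distinct [x, y, p, q, z]" using y z p q pz qy pq by auto
  show thesis
    by (rule that[OF S dist]) (use z(2) p(2) v(2) \<open>v = q\<close> Dq q(2) in \<open>simp_all add: insert_commute\<close>)
qed

section \<open>Signed graphs whose negative edges form a perfect matching\<close>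

text \<open>
  \<open>P\<close> is the positive adjacency and \<open>m\<close> sends a vertex to its unique negative neighbour.
\<close>

locale matched_srsg =
  fixes X :: "'v set" and P :: "'v \<Rightarrow> 'v \<Rightarrow> bool" and m :: "'v \<Rightarrow> 'v" and a b c :: int
  assumes fin: "finite X" and ne: "X \<noteq> {}"
    and P_in: "P u v \<Longrightarrow> u \<in> X \<and> v \<in> X \<and> u \<noteq> v"
    and P_sym: "P u v \<Longrightarrow> P v u"
    and m_in: "v \<in> X \<Longrightarrow> m v \<in> X"
    and m_m: "v \<in> X \<Longrightarrow> m (m v) = v"
    and m_ne: "v \<in> X \<Longrightarrow> m v \<noteq> v"
    and not_P_m: "\<not> P v (m v)"
    and card_nbrs: "v \<in> X \<Longrightarrow> card {u \<in> X. P v u} = 5"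
    and square: "u \<in> X \<Longrightarrow> v \<in> X \<Longrightarrow>
      (\<Sum>w\<in>X. (of_bool (P u w) - of_bool (w = m u)) * (of_bool (P w v) - of_bool (v = m w))) =
      (if u = v then 6 else if P u v then a else if v = m u then b else c)"
    and closed: "S \<subseteq> X \<Longrightarrow> S \<noteq> {} \<Longrightarrow> (\<And>u v. u \<in> S \<Longrightarrow> P u v \<Longrightarrow> v \<in> S) \<Longrightarrow>
      (\<And>u. u \<in> S \<Longrightarrow> m u \<in> S) \<Longrightarrow> S = X"
begin

definition N :: "'v \<Rightarrow> 'v set" where
  "N v = {u \<in> X. P v u}"

text \<open>The signed adjacency matrix, written as the positive part minus the permutation matrix
  of \<open>m\<close>.\<close>

definition A :: "'v \<Rightarrow> 'v \<Rightarrow> int" where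
  "A u v = of_bool (P u v) - of_bool (v = m u)"

lemma P_commute: "P u v \<longleftrightarrow> P v u"
  using P_sym by blast

lemma in_N: "u \<in> N v \<longleftrightarrow> P v u"
  using P_in by (auto simp: N_def)

lemma N_sub: "N v \<subseteq> X"
  by (auto simp: N_def)

lemma fin_N [simp]: "finite (N v)"
  using fin by (simp add: N_def)

lemma card_N: "v \<in> X \<Longrightarrow> card (N v) = 5"
  using card_nbrs by (simp add: N_def)

lemma P_irrefl [simp]: "\<not> P v v"
  using P_in by blast

lemma m_eq_iff: "u \<in> X \<Longrightarrow> v \<in> X \<Longrightarrow> v = m u \<longleftrightarrow> u = m v"
  using m_m by metis

lemma even_card: "even (card X)"
  using even_card_involution[of X m] fin m_in m_m m_ne by blast

section \<open>The square of the adjacency matrix\<close>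

lemma A_commute: "u \<in> X \<Longrightarrow> v \<in> X \<Longrightarrow> A u v = A v u"
  unfolding A_def using m_eq_iff P_commute by simp

lemma sum_of_bool_P: "(\<Sum>w\<in>X. of_bool (P u w) * of_bool (P v w)) = int (card (N u \<inter> N v))"
proof -
  have "N u \<inter> N v = X \<inter> {w. P u w \<and> P v w}" by (auto simp: N_def)
  then show ?thesis using fin
    by (simp add: of_bool_conj[symmetric] sum_of_bool_eq del: of_bool_conj)
qed

text \<open>The case distinction becomes a linear combination of I, A, M and J. On a negative edge
  \<open>A\<close> is -1, so I, A and J together give \<open>2 * c - a\<close>; the coefficient of M
  corrects this to \<open>b\<close>.\<close>

lemma square_A:
  assumes "u \<in> X" "v \<in> X"
  shows "(\<Sum>w\<in>X. A u w * A w v) =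
    (6 - c) * of_bool (u = v) + (a - c) * A u v + (a + b - 2 * c) * of_bool (v = m u) + c"
  using square[OF assms] not_P_m[of u] m_ne[OF assms(1)] by (auto simp: A_def)

lemma sum_m: "u \<in> X \<Longrightarrow> (\<Sum>w\<in>X. of_bool (w = m u) * f w) = (f (m u) :: int)"
  using fin m_in[of u] by (simp add: of_bool_def if_distrib[of "\<lambda>x. x * _"] cong: if_cong)

text \<open>Expanding the square of \<open>A\<close> splits walks of length two by sign. Purely
  positive walks are the common neighbours, and the walks with one negative edge enter negatively.
  For \<open>u = v\<close> the doubly negative walk through \<open>m u\<close> contributes 1, which
  turns 6 into 5.\<close>

lemma card_common:
  assumes "u \<in> X" "v \<in> X"
  shows "int (card (N u \<inter> N v)) =
    (if u = v then 5 else if P u v then a else if v = m u then b else c)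
    + of_bool (P (m u) v) + of_bool (P u (m v))"
proof -
  have "(\<Sum>w\<in>X. A u w * A w v) =
      (\<Sum>w\<in>X. of_bool (P u w) * of_bool (P v w) - of_bool (w = m u) * of_bool (P v w)
        - of_bool (w = m v) * of_bool (P u w) + of_bool (w = m u) * of_bool (w = m v))"
    using assms m_eq_iff P_commute
    by (intro sum.cong refl) (simp add: A_def algebra_simps del: of_bool_conj)
  also have "\<dots> = int (card (N u \<inter> N v)) - of_bool (P v (m u)) - of_bool (P u (m v)) + of_bool (m u = m v)"
    using assms by (simp only: sum.distrib sum_subtractf sum_of_bool_P sum_m)
  finally show ?thesis
    using square[OF assms] assms m_m P_commute unfolding A_def by (smt (verit, best) of_bool_eq)
qed

lemma sum_A:
  assumes "u \<in> X"
  shows "(\<Sum>w\<in>X. A u w) = 4"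
proof -
  have "(\<Sum>w\<in>X. of_bool (P u w) :: int) = 5"
    using card_nbrs[OF assms] fin by (simp add: sum_of_bool_eq Int_def)
  moreover have "(\<Sum>w\<in>X. of_bool (w = m u) :: int) = 1"
    using sum_m[OF assms, of "\<lambda>_. 1"] by simp
  ultimately show ?thesis by (simp add: A_def sum_subtractf)
qed

text \<open>All rows of \<open>A\<close> sum to 4, so those of its square sum to 16; comparing with
  the row sum of the right-hand side of \<open>square_A\<close> gives the relation.\<close>

lemma row_sum: "5 * a + b + c * (int (card X) - 7) = 10"
proof -
  obtain u where u: "u \<in> X" using ne by blast
  have "(\<Sum>v\<in>X. \<Sum>w\<in>X. A u w * A w v) = (\<Sum>w\<in>X. A u w * (\<Sum>v\<in>X. A w v))"
    by (subst sum.swap) (simp add: sum_distrib_left)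
  also have "\<dots> = 16"
    using sum_A u by (simp flip: sum_distrib_right)
  finally have "(\<Sum>v\<in>X. (6 - c) * of_bool (u = v) + (a - c) * A u v
      + (a + b - 2 * c) * of_bool (v = m u) + c) = 16"
    using square_A u by simp
  moreover have "(\<Sum>v\<in>X. of_bool (u = v) :: int) = 1" "(\<Sum>v\<in>X. of_bool (v = m u) :: int) = 1"
    using sum_m[OF u, of "\<lambda>_. 1"] u fin by (simp_all add: of_bool_def)
  ultimately have "(6 - c) + (a - c) * 4 + (a + b - 2 * c) + c * int (card X) = 16"
    using sum_A[OF u] by (simp add: sum.distrib mult.commute[of c] flip: sum_distrib_left)
  then show ?thesis by (simp add: algebra_simps)
qed

text \<open>
  If the coefficient of the matching in the square does not vanish, the matching is a polynomial
  in the adjacency matrix and the all-ones matrix and hence commutes with the former.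
\<close>

lemma m_automorphism:
  assumes "a + b \<noteq> 2 * c" "u \<in> X" "v \<in> X"
  shows "P (m u) v \<longleftrightarrow> P u (m v)"
proof -
  have uv: "m u \<in> X" "m v \<in> X" using assms m_in by auto
  let ?S = "\<lambda>x y. \<Sum>w\<in>X. A x w * A w y"
  \<comment> \<open>Associativity of the triple product. When the square is expanded on either side,
    the terms from I and A agree, and so do those from J because all row sums are 4. What remains is
    the coefficient of M times the difference of MA and AM.\<close>
  have "(\<Sum>w\<in>X. ?S u w * A w v) = (\<Sum>w\<in>X. A u w * ?S w v)"
    unfolding sum_distrib_left sum_distrib_right by (subst sum.swap) (simp add: mult.assoc)
  moreover have "(\<Sum>w\<in>X. ?S u w * A w v) =
      (\<Sum>w\<in>X. (6 - c) * (of_bool (u = w) * A w v) + (a - c) * (A u w * A w v)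
        + (a + b - 2 * c) * (of_bool (w = m u) * A w v) + c * A v w)"
  proof (rule sum.cong[OF refl])
    fix w assume w: "w \<in> X"
    show "?S u w * A w v = (6 - c) * (of_bool (u = w) * A w v) + (a - c) * (A u w * A w v)
        + (a + b - 2 * c) * (of_bool (w = m u) * A w v) + c * A v w"
      unfolding square_A[OF assms(2) w] A_commute[OF assms(3) w] by (simp only: algebra_simps)
  qed
  moreover have "\<dots> = (6 - c) * A u v + (a - c) * ?S u v + (a + b - 2 * c) * A (m u) v + c * 4"
    using assms fin sum_m[of u "\<lambda>w. A w v"] sum_A[of v]
    by (simp add: sum.distrib flip: sum_distrib_left)
  moreover have "(\<Sum>w\<in>X. A u w * ?S w v) =
      (\<Sum>w\<in>X. (6 - c) * (of_bool (w = v) * A u w) + (a - c) * (A u w * A w v)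
        + (a + b - 2 * c) * (of_bool (w = m v) * A u w) + c * A u w)"
  proof (rule sum.cong[OF refl])
    fix w assume w: "w \<in> X"
    show "A u w * ?S w v = (6 - c) * (of_bool (w = v) * A u w) + (a - c) * (A u w * A w v)
        + (a + b - 2 * c) * (of_bool (w = m v) * A u w) + c * A u w"
      unfolding square_A[OF w assms(3)] m_eq_iff[OF w assms(3)] by (simp only: algebra_simps)
  qed
  moreover have "\<dots> = (6 - c) * A u v + (a - c) * ?S u v + (a + b - 2 * c) * A u (m v) + c * 4"
    using assms fin sum_m[of v "\<lambda>w. A u w"] sum_A[of u]
    by (simp add: sum.distrib flip: sum_distrib_left)
  ultimately have "A (m u) v = A u (m v)" using assms(1) by simp
  \<comment> \<open>The negative parts of the two entries agree, so the positive parts do as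
    well.\<close>
  moreover have "m v = m u \<longleftrightarrow> v = u" "v = m (m u) \<longleftrightarrow> v = u" using assms m_m by metis+
  ultimately have "of_bool (P (m u) v) = (of_bool (P u (m v)) :: int)" by (simp add: A_def)
  then show ?thesis by (simp only: of_bool_eq_iff)
qed

section \<open>Common neighbours of matched vertices, and the coefficient of the matching\<close>

text \<open>A walk from \<open>v\<close> to \<open>m v\<close> with one negative edge would need a
  positive loop, so both correction terms of \<open>card_common\<close> vanish.\<close>

lemma card_N_N_m: "v \<in> X \<Longrightarrow> int (card (N v \<inter> N (m v))) = b"
  using card_common[of v "m v"] m_in m_m m_ne[of v] not_P_m[of v] by auto

text \<open>If \<open>b = 5\<close>, then \<open>x\<close> and \<open>m x\<close> have the same
  neighbourhood for every \<open>x\<close>, so \<open>m\<close> acts without fixed points on the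
  five-element set \<open>N v\<close>, against parity.\<close>

lemma b_bounds: "0 \<le> b" "b \<le> 4"
proof -
  obtain v where v: "v \<in> X" using ne by blast
  show "0 \<le> b" using card_N_N_m[OF v] by simp
  have "b \<le> 5" using card_N_N_m[OF v] card_N[OF v] card_mono[of "N v" "N v \<inter> N (m v)"] by simp
  moreover have "b \<noteq> 5"
  proof
    assume b5: "b = 5"
    have eq: "N x = N (m x)" if "x \<in> X" for x
    proof -
      have "card (N x \<inter> N (m x)) = 5" using card_N_N_m[OF that] b5 by simp
      then show ?thesis using that m_in card_N
        by (metis card_subset_eq fin_N inf.cobounded1 inf.cobounded2)
    qed
    have "even (card (N v))"
    proof (rule even_card_involution[where f = m])
      fix x assume "x \<in> N v"
      then have "P x v" "x \<in> X" using in_N P_sym P_in by blast+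
      then have "P (m x) v" using eq in_N by blast
      then show "m x \<in> N v \<and> m (m x) = x \<and> m x \<noteq> x"
        using in_N P_sym \<open>x \<in> X\<close> m_m m_ne by blast
    qed simp
    then show False using card_N[OF v] by simp
  qed
  ultimately show "b \<le> 4" by linarith
qed

lemma card_two_nbhds:
  assumes "v \<in> X"
  shows "int (card (insert v (insert (m v) (N v \<union> N (m v))))) = 12 - b"
proof -
  have "v \<notin> insert (m v) (N v \<union> N (m v))" "m v \<notin> N v \<union> N (m v)"
    using assms m_ne[OF assms] not_P_m in_N P_sym by (auto, metis)
  then have "card (insert v (insert (m v) (N v \<union> N (m v)))) = Suc (Suc (card (N v \<union> N (m v))))"
    by simp
  moreover have "card (N v \<union> N (m v)) + card (N v \<inter> N (m v)) = 10"
    using card_Un_Int[of "N v" "N (m v)"] card_N assms m_in by simp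
  ultimately show ?thesis using card_N_N_m[OF assms] by linarith
qed

lemma card_X_ge: "12 - b \<le> int (card X)"
proof -
  obtain v where v: "v \<in> X" using ne by blast
  have "insert v (insert (m v) (N v \<union> N (m v))) \<subseteq> X"
    using v m_in N_sub by auto
  then show ?thesis using card_two_nbhds[OF v] fin card_mono by (metis zle_int)
qed

text \<open>The sum counts ordered triangles, on which the cyclic rotation has order 3 and no fixed
  point.\<close>

lemma three_dvd_ordered_triangles: "3 dvd (\<Sum>u\<in>X. \<Sum>v\<in>N u. card (N u \<inter> N v))"
proof -
  have "3 dvd card (SIGMA u:X. SIGMA v:N u. N u \<inter> N v)"
    by (rule three_dvd_card_rotation[where f = "\<lambda>(u, v, w). (v, w, u)"])
       (use fin in_N P_sym P_in in \<open>auto\<close>)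
  then show ?thesis using fin by simp
qed

text \<open>
  Otherwise the row sum and divisibility only leave the parameters \<open>(10, 6, 0, 4, 2)\<close>, for which
  the positive edges would span \<open>80\<close> ordered triangles, a number not divisible by \<open>3\<close>.
\<close>

lemma coefficient_nonzero: "a + b \<noteq> 2 * c"
proof
  assume ab: "a + b = 2 * c"
  \<comment> \<open>This is \<open>row_sum\<close> after eliminating
    \<open>a = 2 * c - b\<close>.\<close>
  have *: "c * (int (card X) + 3) = 10 + 4 * b"
  proof -
    have "a = 2 * c - b" using ab by simp
    then show ?thesis using row_sum by (simp add: algebra_simps)
  qed
  have "0 < c"
  proof (rule ccontr)
    assume "\<not> 0 < c"
    then have "c * (int (card X) + 3) \<le> 0" by (intro mult_nonpos_nonneg) auto
    then show False using * b_bounds(1) by linarith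
  qed
  obtain k where k: "card X = 2 * k" using even_card by blast
  have "8 \<le> 2 * int k" using card_X_ge b_bounds k by simp
  \<comment> \<open>The order is at least 8, so \<open>3 \<le> c\<close> would make the left side of
    \<open>*\<close> at least 33, while the right side is at most 26.\<close>
  moreover have "c \<le> 2"
  proof (rule ccontr)
    assume "\<not> c \<le> 2"
    then have "3 * 11 \<le> c * (int (card X) + 3)"
      using calculation k by (intro mult_mono) auto
    then show False using * b_bounds(2) by linarith
  qed
  \<comment> \<open>For \<open>c = 1\<close> the order would be \<open>7 + 4 * b\<close>, which is
    odd. For \<open>c = 2\<close> it is \<open>2 + 2 * b\<close>, and the bound
    \<open>12 - b\<close> forces \<open>b = 4\<close>.\<close>
  ultimately have "c = 2 \<and> b = 4 \<and> card X = 10"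
    using * \<open>0 < c\<close> b_bounds card_X_ge k by (cases "c = 1"; cases "c = 2"; presburger)
  then have c: "c = 2" "b = 4" "a = 0" "card X = 10" using ab by auto
  \<comment> \<open>As \<open>a = 0\<close>, the common neighbours of an adjacent pair are accounted
    for by the two correction terms alone. Summed over all pairs, each term gives the sum of
    \<open>card (N u \<inter> N (m u))\<close>, which is 10 times 4.\<close>
  have "int (\<Sum>u\<in>X. \<Sum>v\<in>N u. card (N u \<inter> N v)) =
      (\<Sum>u\<in>X. \<Sum>v\<in>X. of_bool (P u v) * int (card (N u \<inter> N v)))"
  proof -
    have "(\<Sum>v\<in>N u. int (card (N u \<inter> N v))) = (\<Sum>v\<in>X. of_bool (P u v) * int (card (N u \<inter> N v)))" for u
      using fin by (simp add: N_def sum.inter_filter of_bool_def if_distrib[of "\<lambda>x. x * _"] cong: if_cong)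
    then show ?thesis by simp
  qed
  also have "\<dots> = (\<Sum>u\<in>X. \<Sum>v\<in>X. of_bool (P v u) * of_bool (P v (m u)) + of_bool (P u v) * of_bool (P u (m v)))"
    using card_common c(3) P_commute by (intro sum.cong refl) auto
  also have "\<dots> = (\<Sum>u\<in>X. \<Sum>v\<in>X. of_bool (P v u) * of_bool (P v (m u))) +
      (\<Sum>u\<in>X. \<Sum>v\<in>X. of_bool (P u v) * of_bool (P u (m v)))"
    by (simp only: sum.distrib)
  also have "(\<Sum>u\<in>X. \<Sum>v\<in>X. of_bool (P u v) * of_bool (P u (m v)) :: int) =
       (\<Sum>u\<in>X. \<Sum>v\<in>X. of_bool (P v u) * of_bool (P v (m u)))"
    by (rule sum.swap)
  also have "\<dots> = (\<Sum>u\<in>X. int (card (N u \<inter> N (m u))))"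
    unfolding sum_of_bool_P[symmetric] using P_commute by simp
  also have "\<dots> = 40" using card_N_N_m c by simp
  finally have "int (\<Sum>u\<in>X. \<Sum>v\<in>N u. card (N u \<inter> N v)) = 80" by simp
  then have "(\<Sum>u\<in>X. \<Sum>v\<in>N u. card (N u \<inter> N v)) = 80" by linarith
  then show False using three_dvd_ordered_triangles by simp
qed

section \<open>The matching as an automorphism of the positive graph\<close>

lemmas P_m = m_automorphism[OF coefficient_nonzero]

lemma P_m_m: "u \<in> X \<Longrightarrow> v \<in> X \<Longrightarrow> P (m u) (m v) \<longleftrightarrow> P u v"
  using P_m m_m m_in by metis

lemma P_left_m: "u \<in> X \<Longrightarrow> v \<in> X \<Longrightarrow> P (m u) v \<longleftrightarrow> P u (m v)"
  by (rule P_m)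

text \<open>Because \<open>m\<close> is an automorphism, the two correction terms of
  \<open>card_common\<close> coincide, whence the factor 2.\<close>

lemma card_common_adj:
  assumes "P v u"
  shows "int (card (N u \<inter> N v)) = a + 2 * of_bool (u \<in> N (m v))"
proof -
  have "u \<in> X" "v \<in> X" "u \<noteq> v" "P u v" using assms P_in P_sym by blast+
  then show ?thesis
    using card_common[of u v] P_left_m[of v u] P_commute[of u "m v"] P_left_m[of u v]
    by (simp add: in_N)
qed

lemma nbr_facts:
  assumes "u \<in> N v"
  shows "u \<in> X" "v \<in> X" "v \<in> N u" "u \<noteq> v" "m u \<noteq> v"
proof -
  have uv: "P v u" "P u v" using assms in_N P_sym by blast+
  then show u: "u \<in> X" and "v \<in> X" and "v \<in> N u" and "u \<noteq> v"
    using P_in in_N by blast+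
  show "m u \<noteq> v" using uv(2) not_P_m by blast
qed

lemma N_m:
  assumes "v \<in> X"
  shows "N (m v) = m ` N v"
proof
  show "N (m v) \<subseteq> m ` N v"
  proof
    fix x assume "x \<in> N (m v)"
    then have x: "x \<in> X" "P (m v) x" using in_N N_sub by blast+
    then have "m x \<in> N v" using P_left_m assms in_N by blast
    then show "x \<in> m ` N v" using x m_m by (metis imageI)
  qed
  show "m ` N v \<subseteq> N (m v)"
    using assms P_m_m N_sub in_N by blast
qed

text \<open>Handshake lemma in the graph induced on \<open>N v\<close>: its degree sum is
  \<open>5 * a\<close> plus an even number.\<close>

lemma even_a: "even a"
proof -
  obtain v where v: "v \<in> X" using ne by blast
  have "even (\<Sum>x\<in>N v. card (N x \<inter> N v))"
    by (rule even_sum_card_nbrs) (use in_N P_sym P_in in auto)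
  then have "even (\<Sum>x\<in>N v. int (card (N x \<inter> N v)))"
    by (metis even_of_nat of_nat_sum)
  also have "(\<Sum>x\<in>N v. int (card (N x \<inter> N v))) = (\<Sum>x\<in>N v. a + 2 * of_bool (x \<in> N (m v)))"
    using card_common_adj in_N by (intro sum.cong) auto
  also have "\<dots> = 5 * a + 2 * (\<Sum>x\<in>N v. of_bool (x \<in> N (m v)))"
    using card_N[OF v] by (simp only: sum.distrib sum_constant flip: sum_distrib_left)
  finally show ?thesis by simp
qed

text \<open>
  If \<open>b \<noteq> 0\<close>, then \<open>a = 0\<close> and \<open>b = 4\<close>: the vertices \<open>v\<close>, \<open>m v\<close> and their four common neighbours form
  an octahedron, and \<open>v\<close> has one more positive neighbour \<open>z\<close>. The neighbours of \<open>z\<close> then force \<open>card X \<ge> 12\<close>, against the row sum.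
\<close>

lemma b_zero: "b = 0"
proof (rule ccontr)
  assume b0: "b \<noteq> 0"
  obtain v where v: "v \<in> X" using ne by blast
  define C where "C = N v \<inter> N (m v)"
  have C_sub: "C \<subseteq> N v" and fin_C: "finite C" and card_C: "int (card C) = b"
    using card_N_N_m[OF v] by (auto simp: C_def)
  have m_C: "m x \<in> C" if "x \<in> C" for x
  proof -
    have "x \<in> X" "P v x" "P (m v) x" using that in_N N_sub unfolding C_def by blast+
    then show ?thesis using v m_in P_left_m P_m_m m_m by (auto simp: in_N C_def)
  qed
  have C_facts: "x \<in> N v" "x \<in> X" "m x \<in> N v" "m x \<noteq> x" if "x \<in> C" for x
    using that m_C C_sub N_sub m_ne by blast+
  have "C \<noteq> N v" using card_N[OF v] card_C b_bounds(2) by auto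
  then obtain z where z: "z \<in> N v" "z \<notin> C" using C_sub by blast
  \<comment> \<open>Inside \<open>N v\<close> a vertex has degree \<open>a\<close> or
    \<open>a + 2\<close>, according to whether it is also adjacent to \<open>m v\<close>.\<close>
  have card_outside: "int (card (N u \<inter> N v)) = a" if "u \<in> N v" "u \<notin> C" for u
    using that card_common_adj[of v u] by (simp add: in_N C_def)
  have card_inside: "int (card (N u \<inter> N v)) = a + 2" if "u \<in> C" for u
    using that card_common_adj[of v u] by (simp add: in_N C_def)
  have "C \<noteq> {}" using card_C b0 by auto
  then obtain x where x: "x \<in> C" by blast
  have x_m: "N x \<inter> N v \<subseteq> N v - {x, m x}"
    using not_P_m by (auto simp: in_N)
  \<comment> \<open>A vertex \<open>x\<close> of \<open>C\<close> is adjacent neither to itself nor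
    to \<open>m x\<close>, which leaves three possible neighbours in \<open>N v\<close>; evenness of
    \<open>a\<close> does the rest.\<close>
  have "a = 0"
  proof -
    have "card (N v - {x, m x}) = 3"
      using C_facts[OF x] card_N[OF v] by (subst card_Diff_subset) (auto simp: card_insert_if)
    then have "a + 2 \<le> 3"
      using card_inside[OF x] card_mono[OF _ x_m] by simp
    moreover have "0 \<le> a" using card_outside[OF z] by simp
    ultimately show ?thesis using even_a by presburger
  qed
  have isolated: "N y \<inter> N v = {}" if "y \<in> N v" "y \<notin> C" for y
    using card_outside[OF that] \<open>a = 0\<close> by simp
  \<comment> \<open>Vertices of \<open>N v\<close> outside \<open>C\<close> are isolated there, so
    both neighbours of \<open>x\<close> in \<open>N v\<close> lie in \<open>C\<close>. Hence
    \<open>C\<close> has at least four elements.\<close>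
  have "N x \<inter> N v \<subseteq> C - {x, m x}"
  proof
    fix y assume y: "y \<in> N x \<inter> N v"
    then have "x \<in> N y" using in_N P_sym by blast
    then have "y \<in> C" using isolated[of y] y C_facts(1)[OF x] by blast
    then show "y \<in> C - {x, m x}" using y x_m by blast
  qed
  then have "card (N x \<inter> N v) \<le> card (C - {x, m x})"
    using fin_C by (intro card_mono) auto
  also have "\<dots> = card C - 2"
    using C_facts[OF x] x m_C[OF x] fin_C by (subst card_Diff_subset) (auto simp: card_insert_if)
  finally have b4: "b = 4"
    using card_inside[OF x] \<open>a = 0\<close> card_C b_bounds(2) by simp
  have "N v = insert z C"
  proof (rule card_subset_eq[symmetric])
    show "insert z C \<subseteq> N v" using z C_sub by blast
    show "card (insert z C) = card (N v)"
      using card_N[OF v] card_C b4 z fin_C by simp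
  qed simp
  then have Nm: "N (m v) \<subseteq> insert (m z) C"
    using N_m[OF v] m_C by auto
  define Y where "Y = insert v (insert (m v) (N v \<union> N (m v)))"
  have "N z \<inter> C = {}" using isolated[OF z] C_sub by blast
  moreover have "m z \<notin> N z" using not_P_m by (simp add: in_N)
  moreover have "m v \<notin> N z"
  proof
    assume "m v \<in> N z"
    then have "z \<in> N (m v)" using in_N P_sym by blast
    then show False using z by (simp add: C_def)
  qed
  \<comment> \<open>Apart from \<open>v\<close>, no neighbour of \<open>z\<close> is among the eight
    vertices of \<open>Y\<close>; this adds four new vertices.\<close>
  ultimately have "Y \<inter> (N z - {v}) = {}"
    using isolated[OF z] Nm unfolding Y_def by blast
  moreover have "card (N z - {v}) = 4"
    using card_N[OF nbr_facts(1)[OF z(1)]] nbr_facts(3)[OF z(1)] by simp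
  moreover have "card Y = 8" using card_two_nbhds[OF v] b4 by (simp add: Y_def)
  moreover have "finite Y" by (simp add: Y_def)
  ultimately have "card (Y \<union> (N z - {v})) = 12" by (simp add: card_Un_disjoint)
  moreover have "Y \<union> (N z - {v}) \<subseteq> X"
    using v m_in N_sub unfolding Y_def by blast
  ultimately have n12: "12 \<le> card X" using fin card_mono by metis
  \<comment> \<open>The order is at least 12, so \<open>2 \<le> c\<close> would make this product at
    least 10. Thus \<open>c = 1\<close> and the order is 13, which is odd.\<close>
  have eq: "c * (int (card X) - 7) = 6" using row_sum \<open>a = 0\<close> b4 by simp
  have "0 < c"
    by (rule ccontr) (use eq n12 mult_nonpos_nonneg[of c "int (card X) - 7"] in linarith)
  moreover have "c < 2"
  proof (rule ccontr)
    assume "\<not> c < 2"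
    then have "2 * 5 \<le> c * (int (card X) - 7)" using n12 by (intro mult_mono) auto
    then show False using eq by simp
  qed
  ultimately have "card X = 13" using eq by (cases "c = 1") auto
  then show False using even_card by simp
qed

lemma N_disjoint: "v \<in> X \<Longrightarrow> N v \<inter> N (m v) = {}"
  using card_N_N_m[of v] b_zero by simp

lemma card_common_N: "u \<in> N v \<Longrightarrow> int (card (N u \<inter> N v)) = a"
  using card_common_adj[of v u] N_disjoint[of v] nbr_facts(2)[of u v] in_N by auto

text \<open>By \<open>card_common_N\<close>, \<open>a\<close> is the degree of a graph on the five
  vertices of \<open>N v\<close>, hence at most 4; it is even by \<open>even_a\<close>.\<close>

lemma a_cases: "a \<in> {0, 2, 4}"
proof -
  obtain v where v: "v \<in> X" using ne by blast
  then have "N v \<noteq> {}" using card_N by force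
  then obtain u where u: "u \<in> N v" by blast
  have "N u \<inter> N v \<subseteq> N v - {u}" by (auto simp: in_N)
  then have "card (N u \<inter> N v) \<le> 4"
    using card_N[OF v] u card_mono[of "N v - {u}"] by fastforce
  then have "0 \<le> a" "a \<le> 4" using card_common_N[OF u] by simp_all
  then show ?thesis using even_a by auto
qed

section \<open>The cases \<open>a = 0\<close>, \<open>a = 4\<close> and \<open>a = 2\<close>\<close>

lemma m_image:
  assumes "v \<in> X"
  shows "m ` insert v (N v) = insert (m v) (N (m v))"
    and "m ` insert (m v) (N v) = insert v (N (m v))"
  using N_m[OF assms] m_m[OF assms] by auto

lemma complete_bipartite_case:
  assumes "a = 0"
  obtains S where "card S = 6" "X = S \<union> m ` S" "S \<inter> m ` S = {}"
    "\<And>x y. x \<in> S \<Longrightarrow> y \<in> S \<Longrightarrow> \<not> P x y \<and> (P x (m y) \<longleftrightarrow> x \<noteq> y)"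
proof -
  obtain v where v: "v \<in> X" using ne by blast
  have n12: "12 \<le> card X" using card_X_ge b_zero by simp
  have eq: "c * (int (card X) - 7) = 10" using row_sum b_zero assms by simp
  have "0 < c"
    by (rule ccontr) (use eq n12 mult_nonpos_nonneg[of c "int (card X) - 7"] in linarith)
  moreover have "c < 3"
  proof (rule ccontr)
    assume "\<not> c < 3"
    then have "3 * 5 \<le> c * (int (card X) - 7)" using n12 by (intro mult_mono) auto
    then show False using eq by simp
  qed
  \<comment> \<open>The value 1 would give the odd order 17.\<close>
  moreover have "c \<noteq> 1"
  proof
    assume "c = 1"
    then have "card X = 17" using eq by simp
    then show False using even_card by simp
  qed
  ultimately have "c = 2" by linarith
  then have card_X: "card X = 12" using eq by simp
  \<comment> \<open>The side containing \<open>N v\<close> contains \<open>m v\<close> rather than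
    \<open>v\<close>: \<open>v\<close> is adjacent to \<open>N v\<close>, and \<open>m v\<close> to
    none of it.\<close>
  define S where "S = insert (m v) (N v)"
  have mS: "m ` S = insert v (N (m v))" using m_image v by (simp add: S_def)
  have X: "X = S \<union> m ` S"
  proof (rule card_subset_eq[symmetric])
    show "S \<union> m ` S \<subseteq> X" using v m_in N_sub unfolding mS S_def by blast
    have "S \<union> m ` S = insert v (insert (m v) (N v \<union> N (m v)))"
      unfolding mS by (auto simp: S_def)
    then show "card (S \<union> m ` S) = card X"
      using card_two_nbhds[OF v] b_zero card_X by simp
  qed (fact fin)
  have mv: "m v \<notin> N v" "v \<noteq> m v" using not_P_m m_ne[OF v] by (auto simp: in_N)
  then have card_S: "card S = 6" using card_N[OF v] by (simp add: S_def)
  have disj: "S \<inter> m ` S = {}"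
    unfolding mS using N_disjoint[OF v] mv in_N by (auto simp: S_def)
  have tri: "N u \<inter> N w = {}" if "u \<in> N w" for u w
    using card_common_N[OF that] assms by simp
  have ind: "\<not> P x y" if x: "x \<in> S" and y: "y \<in> S" for x y
  proof
    assume P: "P x y"
    have *: "\<not> P s t" if "s \<in> N v" "t \<in> S" for s t
    proof
      assume st: "P s t"
      have "t \<noteq> m v" using st that(1) N_disjoint[OF v] in_N P_sym by blast
      then have "t \<in> N s \<inter> N v" using that st by (auto simp: S_def in_N)
      then show False using tri[OF that(1)] by blast
    qed
    have "x = m v" "y = m v" using * P P_sym x y unfolding S_def by blast+
    then show False using P by simp
  qed
  have "P x (m y) \<longleftrightarrow> x \<noteq> y" if x: "x \<in> S" and y: "y \<in> S" for x y
  proof -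
    have xX: "x \<in> X" using x X by blast
    have "N x = m ` S - {m x}"
    proof (rule card_subset_eq)
      show "N x \<subseteq> m ` S - {m x}"
      proof
        fix w assume "w \<in> N x"
        then have w: "w \<in> X" "P x w" using N_sub in_N by blast+
        then have "w \<notin> S" "w \<noteq> m x" using ind x not_P_m by blast+
        then show "w \<in> m ` S - {m x}" using w X by blast
      qed
      have "inj_on m X" by (rule inj_on_inverseI[where g = m]) (rule m_m)
      then have "card (m ` S) = 6" using card_S X by (metis card_image inj_on_subset sup_ge1)
      then show "card (N x) = card (m ` S - {m x})" using x card_N[OF xX] by simp
      show "finite (m ` S - {m x})" by (simp add: S_def)
    qed
    moreover have "m y = m x \<longleftrightarrow> x = y" using x y X m_m by (metis UnI1)
    ultimately show ?thesis using y in_N by blast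
  qed
  with that[OF card_S X disj] ind show thesis by blast
qed

text \<open>With degree 4 on five vertices, \<open>N v\<close> is a clique, so \<open>v\<close> and
  its neighbours form a component of the positive graph. This component and its image are closed
  under \<open>P\<close> and \<open>m\<close>, hence connectedness makes them all of
  \<open>X\<close>.\<close>

lemma two_cliques_case:
  assumes "a = 4"
  obtains S where "card S = 6" "X = S \<union> m ` S" "S \<inter> m ` S = {}"
    "\<And>x y. x \<in> S \<Longrightarrow> y \<in> S \<Longrightarrow> (P x y \<longleftrightarrow> x \<noteq> y) \<and> \<not> P x (m y)"
proof -
  obtain v where v: "v \<in> X" using ne by blast
  define S where "S = insert v (N v)"
  have mS: "m ` S = insert (m v) (N (m v))" using m_image v by (simp add: S_def)
  have card_S: "card S = 6" using card_N[OF v] by (simp add: S_def in_N)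
  have SX: "S \<subseteq> X" using v N_sub by (simp add: S_def)
  have N_S: "N x = S - {x}" if x: "x \<in> S" for x
  proof (cases "x = v")
    case True
    then show ?thesis by (auto simp: S_def in_N)
  next
    case False
    then have xv: "x \<in> N v" using x by (simp add: S_def)
    have "N x \<inter> N v = N v - {x}"
    proof (rule card_subset_eq)
      show "N x \<inter> N v \<subseteq> N v - {x}" by (auto simp: in_N)
      show "card (N x \<inter> N v) = card (N v - {x})"
        using card_common_N[OF xv] assms card_N[OF v] xv by simp
    qed simp
    then have "S - {x} \<subseteq> N x" using nbr_facts(3)[OF xv] by (auto simp: S_def)
    moreover have "card (S - {x}) = card (N x)"
      using card_S x card_N[of x] SX by (simp add: subset_iff)
    ultimately show ?thesis by (metis card_subset_eq fin_N)
  qed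
  have disj: "S \<inter> m ` S = {}"
    unfolding mS using N_disjoint[OF v] m_ne[OF v] not_P_m P_sym by (auto simp: S_def in_N)
  have cl: "v' \<in> S \<union> m ` S" if uv: "u \<in> S \<union> m ` S" "P u v'" for u v'
  proof (cases "u \<in> S")
    case True
    then show ?thesis using N_S uv(2) in_N by blast
  next
    case False
    then obtain x where x: "x \<in> S" "u = m x" using uv(1) by blast
    have "v' \<in> X" using uv(2) P_in by blast
    then have "m v' \<in> N x" using uv(2) x SX P_left_m in_N by blast
    then have "m v' \<in> S" using N_S[OF x(1)] by blast
    then show ?thesis using m_m[OF \<open>v' \<in> X\<close>] by (metis UnI2 imageI)
  qed
  have "S \<union> m ` S = X"
  proof (rule closed)
    show "S \<union> m ` S \<subseteq> X" using SX m_in by blast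
    show "S \<union> m ` S \<noteq> {}" by (simp add: S_def)
    show "m u \<in> S \<union> m ` S" if "u \<in> S \<union> m ` S" for u
      using that m_m SX by auto
  qed (fact cl)
  moreover have "(P x y \<longleftrightarrow> x \<noteq> y) \<and> \<not> P x (m y)" if "x \<in> S" "y \<in> S" for x y
    using N_S[OF that(1)] that(2) disj in_N by blast
  ultimately show thesis using that[OF card_S _ disj] by blast
qed

text \<open>Here the row sum gives \<open>c = 0\<close>. Vertices at positive distance two from
  \<open>v\<close> are then \<open>m v\<close> or neighbours of \<open>m v\<close>, so two disjoint
  neighbourhoods and their centres fill \<open>X\<close>. The pentagon on \<open>N v\<close> and the
  rule for edges to its image determine everything.\<close>

lemma icosahedron_case:
  assumes "a = 2"
  obtains v x y p q z where
    "X = {v, m v} \<union> {x, y, p, q, z} \<union> m ` {x, y, p, q, z}"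
    "card X = 12" "N v = {x, y, p, q, z}" "distinct [x, y, p, q, z]"
    "N x \<inter> N v = {z, y}" "N y \<inter> N v = {x, p}" "N p \<inter> N v = {y, q}"
    "N q \<inter> N v = {p, z}" "N z \<inter> N v = {q, x}"
    "\<And>s t. s \<in> N v \<Longrightarrow> t \<in> N v \<Longrightarrow> P s (m t) \<longleftrightarrow> s \<noteq> t \<and> \<not> P s t"
proof -
  obtain v where v: "v \<in> X" using ne by blast
  have "c * (int (card X) - 7) = 0" using row_sum b_zero assms by simp
  moreover have "12 \<le> card X" using card_X_ge b_zero by simp
  ultimately have "c = 0" by auto
  \<comment> \<open>With \<open>c = 0\<close>, the common neighbours of such a pair come only from
    the correction terms; since \<open>z\<close> is one, these terms cannot vanish.\<close>
  have distant: "P (m u) w" if uw: "u \<in> X" "w \<in> X" "u \<noteq> w" "\<not> P u w" "w \<noteq> m u"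
    and z: "P z u" "P z w" for u w z
  proof -
    have "z \<in> N u \<inter> N w" using z P_sym in_N by blast
    then have "card (N u \<inter> N w) \<noteq> 0" by auto
    then show ?thesis
      using card_common[OF uw(1,2)] uw \<open>c = 0\<close> P_left_m[OF uw(1,2)] by auto
  qed
  define Y where "Y = insert v (insert (m v) (N v \<union> N (m v)))"
  have near: "y \<in> insert u (N u \<union> N (m u))" if "u \<in> X" "x \<in> N u" "P x y" for u x y
  proof (rule ccontr)
    assume y: "y \<notin> insert u (N u \<union> N (m u))"
    \<comment> \<open>Otherwise \<open>x\<close> would be a common neighbour of \<open>u\<close> and
      \<open>m u\<close>.\<close>
    have "y \<noteq> m u" using that N_disjoint[OF that(1)] in_N P_sym by blast
    moreover have "y \<in> X" "P x u" using that P_in P_sym in_N by blast+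
    ultimately show False using distant[of u y x] that y in_N by blast
  qed
  have "Y = X"
  proof (rule closed)
    show "Y \<subseteq> X" using v m_in N_sub unfolding Y_def by blast
    show "Y \<noteq> {}" by (simp add: Y_def)
    show "m u \<in> Y" if "u \<in> Y" for u
      using that v N_m[OF v] m_m[OF v] m_m N_sub by (auto simp: Y_def image_iff subset_iff)
    show "w \<in> Y" if uw: "u \<in> Y" "P u w" for u w
    proof -
      consider "u = v" | "u = m v" | "u \<in> N v" | "u \<in> N (m v)"
        using uw(1) unfolding Y_def by blast
      then show ?thesis
      proof cases
        case 3
        then show ?thesis using near[OF v 3 uw(2)] by (auto simp: Y_def)
      next
        case 4
        then show ?thesis
          using near[OF m_in[OF v] 4 uw(2)] m_m[OF v] by (auto simp: Y_def)
      qed (use uw(2) in \<open>auto simp: Y_def in_N\<close>)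
    qed
  qed
  then have X: "X = {v, m v} \<union> N v \<union> m ` N v" and card_X: "card X = 12"
    using card_two_nbhds[OF v] b_zero N_m[OF v] by (auto simp: Y_def)
  have opp: "P s (m t) \<longleftrightarrow> s \<noteq> t \<and> \<not> P s t" if st: "s \<in> N v" "t \<in> N v" for s t
  proof -
    have X': "s \<in> X" "t \<in> X" using st N_sub by blast+
    have "\<not> P s (m t)" if "P s t"
    proof
      assume "P s (m t)"
      then have "s \<in> N t \<inter> N (m t)" using that P_sym in_N by blast
      then show False using N_disjoint X' by blast
    qed
    moreover have "P s (m t)" if "s \<noteq> t" "\<not> P s t"
    proof -
      have "t \<noteq> m s" using st N_disjoint[OF v] v X' P_left_m[of v s] in_N by blast
      \<comment> \<open>The common neighbour needed for \<open>distant\<close> is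
        \<open>v\<close>.\<close>
      then have "P (m s) t" using distant[of s t v] X' that st in_N by blast
      then show ?thesis using P_left_m X' by blast
    qed
    ultimately show ?thesis using not_P_m by blast
  qed
  show thesis
  proof (rule two_regular_on_five[of "N v" "\<lambda>s. N s \<inter> N v"])
    show "card (N v) = 5" using card_N[OF v] .
    show "card (N s \<inter> N v) = 2" if "s \<in> N v" for s
      using card_common_N[OF that] assms by simp
    show "t \<in> N v \<and> s \<in> N t \<inter> N v \<and> s \<noteq> t" if "s \<in> N v" "t \<in> N s \<inter> N v" for s t
      using that in_N P_sym P_in by blast
    fix x y p q z
    assume S: "N v = {x, y, p, q, z}" and
      "distinct [x, y, p, q, z]"
      "N x \<inter> N v = {z, y}" "N y \<inter> N v = {x, p}" "N p \<inter> N v = {y, q}"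
      "N q \<inter> N v = {p, z}" "N z \<inter> N v = {q, x}"
    with that[of v x y p q z] X[unfolded S] card_X opp show thesis by blast
  qed
qed

end

section \<open>The three graphs\<close>

text \<open>The adjacency matrix relative to an order of the vertices; with it, isomorphism reduces
  to equality of two lists.\<close>

definition adj_rows :: "'v list \<Rightarrow> ('v \<Rightarrow> 'v \<Rightarrow> int) \<Rightarrow> int list list" where
  "adj_rows vs f = map (\<lambda>u. map (f u) vs) vs"

text \<open>
  The matrix is passed explicitly as \<open>R\<close> so that the evaluation below computes every entry only once.
\<close>

definition srsg_check ::
    "'v list \<Rightarrow> ('v \<Rightarrow> 'v \<Rightarrow> int) \<Rightarrow> int list list \<Rightarrow> int \<Rightarrow> int \<Rightarrow> int \<Rightarrow> bool" where
  "srsg_check vs f R a b c \<longleftrightarrow>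
     list_all (\<lambda>u. list_ex (\<lambda>w. (hd vs = w \<or> f (hd vs) w \<noteq> 0) \<and> (w = u \<or> f w u \<noteq> 0)) vs) vs \<and>
     list_all (\<lambda>(u, ru). length (filter (\<lambda>x. x = 1) ru) = 5 \<and> length (filter (\<lambda>x. x = -1) ru) = 1 \<and>
       list_all (\<lambda>(v, rv). (\<Sum>(x, y)\<leftarrow>zip ru rv. x * y) =
           (if u = v then 6 else if f u v = 1 then a else if f u v = -1 then b else c)) (zip vs R))
       (zip vs R)"

lemma srsg_check_sound:
  assumes G: "signed_graph G" and vs: "sg_verts G = set vs" "distinct vs" "length vs = n" "n \<noteq> 0"
    and f: "\<And>u v. u \<in> set vs \<Longrightarrow> v \<in> set vs \<Longrightarrow> sg_adj_mat G u v = f u v"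
    and R: "adj_rows vs f = R"
    and check: "srsg_check vs f R a b c"
  shows "sg_connected G \<and> sg_regular G 6 \<and> sg_net_regular G 4 \<and> srsg_params G n 6 a b c"
proof -
  have zip_R: "zip vs R = map (\<lambda>u. (u, map (f u) vs)) vs"
    unfolding R[symmetric] adj_rows_def by (simp add: zip_map2 zip_same_conv_map)
  \<comment> \<open>Connectedness is certified by walks of length at most two from the first
    vertex.\<close>
  have reach: "\<exists>w\<in>set vs. (hd vs = w \<or> f (hd vs) w \<noteq> 0) \<and> (w = u \<or> f w u \<noteq> 0)"
    if "u \<in> set vs" for u
    using check that by (simp add: srsg_check_def list_all_iff list_ex_iff)
  have rows: "length (filter (\<lambda>w. f u w = 1) vs) = 5" "length (filter (\<lambda>w. f u w = -1) vs) = 1"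
    "(\<Sum>w\<leftarrow>vs. f u w * f v w) = (if u = v then 6 else if f u v = 1 then a else if f u v = -1 then b else c)"
    if "u \<in> set vs" "v \<in> set vs" for u v
    using check that unfolding srsg_check_def zip_R
    by (simp_all add: list_all_iff length_filter_map o_def zip_map_map zip_same_conv_map)
  have deg: "card {w \<in> set vs. pos_adj G u w} = 5 \<and> card {w \<in> set vs. neg_adj G u w} = 1"
    if u: "u \<in> set vs" for u
  proof -
    have "{w \<in> set vs. pos_adj G u w} = set (filter (\<lambda>w. f u w = 1) vs)"
      "{w \<in> set vs. neg_adj G u w} = set (filter (\<lambda>w. f u w = -1) vs)"
      using f u by (auto simp: pos_adj_iff[OF G] neg_adj_iff[OF G])
    then show ?thesis using rows(1,2)[OF u u] vs(2)
      by (simp only: distinct_card distinct_filter)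
  qed
  define r where "r = hd vs"
  have r: "r \<in> set vs" using vs by (cases vs) (auto simp: r_def)
  have "{w \<in> set vs. pos_adj G r w} \<noteq> {}" "{w \<in> set vs. neg_adj G r w} \<noteq> {}"
    using deg[OF r] by (metis card.empty zero_neq_numeral, metis card.empty zero_neq_one)
  then have hom: "\<not> sg_homogeneous G" "sg_edges G \<noteq> {}"
    using not_homogeneous_if_pos_neg[of G r] by (auto simp: pos_adj_def)
  have "sg_adj_mat_sq G u v =
      (if u = v then int 6 else if pos_adj G u v then a else if neg_adj G u v then b else c)"
    if uv: "u \<in> set vs" "v \<in> set vs" for u v
  proof -
    have "sg_adj_mat_sq G u v = (\<Sum>w\<in>set vs. f u w * f v w)"
      unfolding sg_adj_mat_sq_def vs(1)
    proof (rule sum.cong[OF refl])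
      fix w assume w: "w \<in> set vs"
      \<comment> \<open>The check multiplies rows with rows, which yields the square because the
        matrix is symmetric.\<close>
      have "sg_adj_mat G w v = sg_adj_mat G v w"
        by (simp add: sg_adj_mat_def insert_commute)
      then show "sg_adj_mat G u w * sg_adj_mat G w v = f u w * f v w"
        using uv w by (simp add: f)
    qed
    also have "\<dots> = (\<Sum>w\<leftarrow>vs. f u w * f v w)"
      using vs(2) by (simp add: sum_list_distinct_conv_sum_set)
    finally show ?thesis
      using rows(3)[OF uv] uv by (simp add: f pos_adj_iff[OF G] neg_adj_iff[OF G])
  qed
  moreover have "card (sg_verts G) = n" using vs distinct_card by metis
  ultimately have "srsg_params G n 6 a b c"
    unfolding srsg_params_iff[OF G] using hom vs(1) by simp
  moreover have "sg_connected G"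
  proof -
    let ?E = "{(x, y). {x, y} \<in> sg_edges G}"
    have sym: "sym (?E\<^sup>*)" by (intro sym_rtrancl symI) (simp add: insert_commute)
    have "(r, u) \<in> ?E\<^sup>*" if u: "u \<in> set vs" for u
    proof -
      obtain w where w: "w \<in> set vs" "r = w \<or> f r w \<noteq> 0" "w = u \<or> f w u \<noteq> 0"
        using reach[OF u] r_def by blast
      then have "r = w \<or> (r, w) \<in> ?E" "w = u \<or> (w, u) \<in> ?E"
        using f r u by (auto simp: edge_iff[OF G])
      then show ?thesis by (meson r_into_rtrancl rtrancl.rtrancl_refl rtrancl_trans)
    qed
    then have path: "(u, v) \<in> ?E\<^sup>*" if "u \<in> set vs" "v \<in> set vs" for u v
      using that sym by (meson rtrancl_trans symD)
    show ?thesis unfolding sg_connected_def vs(1)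
    proof (intro conjI ballI)
      show "set vs \<noteq> {}" using r by auto
    qed (rule path)
  qed
  moreover have "sg_regular G 6 \<and> sg_net_regular G 4"
    using pos5_neg1_iff[OF G] deg vs(1) by simp
  ultimately show ?thesis by simp
qed

section \<open>Explicit adjacency matrices\<close>

lemma sg_adj_mat_sg_make:
  "sg_adj_mat (sg_make X E F) u v = (if {u, v} \<in> F then -1 else if {u, v} \<in> E then 1 else 0)"
  by (simp add: sg_adj_mat_def sg_make_def)

lemma sg_verts_sg_make [simp]: "sg_verts (sg_make X E F) = X"
  by (simp add: sg_make_def)

lemma signed_graph_sg_make:
  "finite X \<Longrightarrow> (\<And>e. e \<in> E \<union> F \<Longrightarrow> \<exists>u\<in>X. \<exists>v\<in>X. u \<noteq> v \<and> e = {u, v}) \<Longrightarrow>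
    signed_graph (sg_make X E F)"
  by (simp add: signed_graph_def sg_make_def)

lemma doubleton_edge:
  "u \<in> X \<Longrightarrow> v \<in> X \<Longrightarrow> u \<noteq> v \<Longrightarrow> \<exists>x\<in>X. \<exists>y\<in>X. x \<noteq> y \<and> {u, v} = {x, y}"
  by blast

text \<open>Evaluable entries that stand in for the set comprehensions defining the edges of
  \<open>S12_1\<close>.\<close>

fun adj1 :: "uw \<Rightarrow> uw \<Rightarrow> int" where
  "adj1 (U i) (W j) = (if i = j then -1 else 1)"
| "adj1 (W i) (U j) = (if i = j then -1 else 1)"
| "adj1 _ _ = 0"

fun adj2 :: "uw \<Rightarrow> uw \<Rightarrow> int" where
  "adj2 (U i) (U j) = (if i = j then 0 else 1)"
| "adj2 (W i) (W j) = (if i = j then 0 else 1)"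
| "adj2 (U i) (W j) = (if i = j then -1 else 0)"
| "adj2 (W i) (U j) = (if i = j then -1 else 0)"

definition verts12 :: "uw list" where
  "verts12 = map U [1,2,3,4,5,6] @ map W [1,2,3,4,5,6]"

lemma set_verts12: "set verts12 = U ` {1..6} \<union> W ` {1..6}"
proof -
  have "{1..6::nat} = {1,2,3,4,5,6}" by auto
  then show ?thesis unfolding verts12_def by auto
qed

lemma signed_graph_S12_1: "signed_graph S12_1"
  unfolding S12_1_def by (rule signed_graph_sg_make) (auto intro!: doubleton_edge)

lemma signed_graph_S12_2: "signed_graph S12_2"
  unfolding S12_2_def by (rule signed_graph_sg_make) (auto intro!: doubleton_edge)

lemma sg_verts_S12_1: "sg_verts S12_1 = set verts12"
  by (simp add: S12_1_def set_verts12)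

lemma sg_verts_S12_2: "sg_verts S12_2 = set verts12"
  by (simp add: S12_2_def set_verts12)

lemma sg_adj_mat_S12_1:
  "u \<in> set verts12 \<Longrightarrow> v \<in> set verts12 \<Longrightarrow> sg_adj_mat S12_1 u v = adj1 u v"
  unfolding S12_1_def sg_adj_mat_sg_make set_verts12 by (auto simp: doubleton_eq_iff)

lemma sg_adj_mat_S12_2:
  "u \<in> set verts12 \<Longrightarrow> v \<in> set verts12 \<Longrightarrow> sg_adj_mat S12_2 u v = adj2 u v"
  unfolding S12_2_def sg_adj_mat_sg_make set_verts12 by (auto simp: doubleton_eq_iff) blast+

text \<open>Each edge is listed in one orientation only; \<open>adj3\<close> tests both.\<close>

definition pos3 :: "(nat \<times> nat) list" where
  "pos3 = [(1,3),(1,4),(1,5),(1,6),(1,7),(2,8),(2,9),(2,10),(2,11),(2,12),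
     (3,4),(4,5),(5,6),(6,7),(7,3),(8,9),(9,10),(10,11),(11,12),(12,8),
     (5,8),(6,8),(6,9),(7,9),(3,10),(7,10),(3,11),(4,11),(4,12),(5,12)]"

definition neg3 :: "(nat \<times> nat) list" where
  "neg3 = [(1,2),(3,8),(4,9),(5,10),(6,11),(7,12)]"

definition adj3 :: "nat \<Rightarrow> nat \<Rightarrow> int" where
  "adj3 u v = (if (u, v) \<in> set neg3 \<or> (v, u) \<in> set neg3 then -1
     else if (u, v) \<in> set pos3 \<or> (v, u) \<in> set pos3 then 1 else 0)"

definition verts3 :: "nat list" where
  "verts3 = [1,2,3,4,5,6,7,8,9,10,11,12]"

lemma S12_3_eq:
  "S12_3 = sg_make (set verts3) ((\<lambda>(u, v). {u, v}) ` set pos3) ((\<lambda>(u, v). {u, v}) ` set neg3)"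
proof -
  have "{1..12::nat} = set verts3" "{3..7::nat} = {3,4,5,6,7}" "{8..12::nat} = {8,9,10,11,12}"
    by (auto simp: verts3_def; presburger)+
  moreover have "{{1, k} | k. k \<in> {3,4,5,6,7::nat}} = {{1,3},{1,4},{1,5},{1,6},{1,7}}"
    "{{2, k} | k. k \<in> {8,9,10,11,12::nat}} = {{2,8},{2,9},{2,10},{2,11},{2,12}}"
    by blast+
  ultimately show ?thesis
    unfolding S12_3_def pos3_def neg3_def
    by (simp only: list.set image_insert image_empty prod.case Un_insert_left Un_empty_left)
qed

lemma sg_verts_S12_3: "sg_verts S12_3 = set verts3"
  by (simp add: S12_3_eq)

lemma sg_adj_mat_S12_3: "sg_adj_mat S12_3 u v = adj3 u v"
proof -
  have "{u, v} \<in> (\<lambda>(u, v). {u, v}) ` E \<longleftrightarrow> (u, v) \<in> E \<or> (v, u) \<in> E" for E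
    by (auto simp: doubleton_eq_iff image_iff split: prod.splits)
  then show ?thesis by (simp only: S12_3_eq sg_adj_mat_sg_make adj3_def)
qed

lemma edges3_in_verts3:
  "list_all (\<lambda>(u, v). u \<in> set verts3 \<and> v \<in> set verts3 \<and> u \<noteq> v) (pos3 @ neg3)"
  by code_simp

lemma signed_graph_S12_3: "signed_graph S12_3"
  unfolding S12_3_eq
proof (rule signed_graph_sg_make)
  fix e assume "e \<in> (\<lambda>(u, v). {u, v}) ` set pos3 \<union> (\<lambda>(u, v). {u, v}) ` set neg3"
  then obtain u v where "(u, v) \<in> set (pos3 @ neg3)" "e = {u, v}" by auto
  then show "\<exists>u\<in>set verts3. \<exists>v\<in>set verts3. u \<noteq> v \<and> e = {u, v}"
    using edges3_in_verts3 unfolding list_all_iff by blast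
qed simp

text \<open>In blocks of size six: 0 on the diagonal and J - 2I off it.\<close>

definition rows1 :: "int list list" where
  "rows1 =
    [[0,0,0,0,0,0,-1,1,1,1,1,1],
     [0,0,0,0,0,0,1,-1,1,1,1,1],
     [0,0,0,0,0,0,1,1,-1,1,1,1],
     [0,0,0,0,0,0,1,1,1,-1,1,1],
     [0,0,0,0,0,0,1,1,1,1,-1,1],
     [0,0,0,0,0,0,1,1,1,1,1,-1],
     [-1,1,1,1,1,1,0,0,0,0,0,0],
     [1,-1,1,1,1,1,0,0,0,0,0,0],
     [1,1,-1,1,1,1,0,0,0,0,0,0],
     [1,1,1,-1,1,1,0,0,0,0,0,0],
     [1,1,1,1,-1,1,0,0,0,0,0,0],
     [1,1,1,1,1,-1,0,0,0,0,0,0]]"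

lemma adj_rows_1: "adj_rows verts12 adj1 = rows1"
  by code_simp

lemma srsg_check_1: "srsg_check verts12 adj1 rows1 0 0 2"
  by code_simp

text \<open>In blocks of size six: J - I on the diagonal and -I off it.\<close>

definition rows2 :: "int list list" where
  "rows2 =
    [[0,1,1,1,1,1,-1,0,0,0,0,0],
     [1,0,1,1,1,1,0,-1,0,0,0,0],
     [1,1,0,1,1,1,0,0,-1,0,0,0],
     [1,1,1,0,1,1,0,0,0,-1,0,0],
     [1,1,1,1,0,1,0,0,0,0,-1,0],
     [1,1,1,1,1,0,0,0,0,0,0,-1],
     [-1,0,0,0,0,0,0,1,1,1,1,1],
     [0,-1,0,0,0,0,1,0,1,1,1,1],
     [0,0,-1,0,0,0,1,1,0,1,1,1],
     [0,0,0,-1,0,0,1,1,1,0,1,1],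
     [0,0,0,0,-1,0,1,1,1,1,0,1],
     [0,0,0,0,0,-1,1,1,1,1,1,0]]"

lemma adj_rows_2: "adj_rows verts12 adj2 = rows2"
  by code_simp

lemma srsg_check_2: "srsg_check verts12 adj2 rows2 4 0 (-2)"
  by code_simp

text \<open>The order is an antipodal pair, a pentagon, then its antipodal image. With C the matrix
  of the pentagon, the pentagon blocks are C on the diagonal and J - C - 2I off it.\<close>

definition rows3 :: "int list list" where
  "rows3 =
    [[0,-1,1,1,1,1,1,0,0,0,0,0],
     [-1,0,0,0,0,0,0,1,1,1,1,1],
     [1,0,0,1,0,0,1,-1,0,1,1,0],
     [1,0,1,0,1,0,0,0,-1,0,1,1],
     [1,0,0,1,0,1,0,1,0,-1,0,1],
     [1,0,0,0,1,0,1,1,1,0,-1,0],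
     [1,0,1,0,0,1,0,0,1,1,0,-1],
     [0,1,-1,0,1,1,0,0,1,0,0,1],
     [0,1,0,-1,0,1,1,1,0,1,0,0],
     [0,1,1,0,-1,0,1,0,1,0,1,0],
     [0,1,1,1,0,-1,0,0,0,1,0,1],
     [0,1,0,1,1,0,-1,1,0,0,1,0]]"

lemma adj_rows_3: "adj_rows verts3 adj3 = rows3"
  by code_simp

lemma srsg_check_3: "srsg_check verts3 adj3 rows3 2 0 0"
  by code_simp

lemma props_S12_1:
  "sg_connected S12_1 \<and> sg_regular S12_1 6 \<and> sg_net_regular S12_1 4 \<and> srsg_params S12_1 12 6 0 0 2"
  by (rule srsg_check_sound[OF signed_graph_S12_1 sg_verts_S12_1 _ _ _ sg_adj_mat_S12_1 adj_rows_1 srsg_check_1])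
    (simp_all add: verts12_def)

lemma props_S12_2:
  "sg_connected S12_2 \<and> sg_regular S12_2 6 \<and> sg_net_regular S12_2 4 \<and> srsg_params S12_2 12 6 4 0 (-2)"
  by (rule srsg_check_sound[OF signed_graph_S12_2 sg_verts_S12_2 _ _ _ sg_adj_mat_S12_2 adj_rows_2 srsg_check_2])
    (simp_all add: verts12_def)

lemma props_S12_3:
  "sg_connected S12_3 \<and> sg_regular S12_3 6 \<and> sg_net_regular S12_3 4 \<and> srsg_params S12_3 12 6 2 0 0"
  by (rule srsg_check_sound[OF signed_graph_S12_3 sg_verts_S12_3 _ _ _ sg_adj_mat_S12_3 adj_rows_3 srsg_check_3])
    (simp_all add: verts3_def)

section \<open>Classification\<close>

text \<open>The isomorphism sends the vertex at each position of \<open>vs\<close> to the one at the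
  same position of \<open>ws\<close>.\<close>

lemma sg_iso_if_adj_rows_eq:
  assumes "signed_graph G" "signed_graph H"
    and vs: "sg_verts G = set vs" "distinct vs" and ws: "sg_verts H = set ws" "distinct ws"
    and rows: "adj_rows vs (sg_adj_mat G) = adj_rows ws (sg_adj_mat H)"
  shows "sg_iso G H"
proof -
  have len: "length vs = length ws"
    using arg_cong[OF rows, of length] by (simp add: adj_rows_def)
  have nth: "bij_betw ((!) vs) {..<length vs} (set vs)" "bij_betw ((!) ws) {..<length vs} (set ws)"
    using vs(2) ws(2) len by (auto intro: bij_betw_nth)
  let ?k = "inv_into {..<length vs} ((!) vs)"
  have k: "?k u < length vs" "vs ! ?k u = u" if "u \<in> set vs" for u
    using bij_betwE[OF bij_betw_inv_into[OF nth(1)]] bij_betw_inv_into_right[OF nth(1)] that by auto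
  have entry: "sg_adj_mat H (ws ! i) (ws ! j) = sg_adj_mat G (vs ! i) (vs ! j)"
    if "i < length vs" "j < length vs" for i j
    using arg_cong[OF rows, of "\<lambda>r. r ! i ! j"] that len by (simp add: adj_rows_def)
  show ?thesis
  proof (rule sg_isoI[OF assms(1,2), of "\<lambda>u. ws ! ?k u"])
    show "bij_betw (\<lambda>u. ws ! ?k u) (sg_verts G) (sg_verts H)"
      using bij_betw_trans[OF bij_betw_inv_into[OF nth(1)] nth(2)] vs(1) ws(1) by (simp add: o_def)
    show "sg_adj_mat H (ws ! ?k u) (ws ! ?k v) = sg_adj_mat G u v"
      if "u \<in> sg_verts G" "v \<in> sg_verts G" for u v
      using entry[OF k(1) k(1), of u v] k(2)[of u] k(2)[of v] that vs(1) by simp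
  qed
qed

lemma card_six_obtain:
  assumes "card S = 6"
  obtains p q r s t u where "S = {p, q, r, s, t, u}" "distinct [p, q, r, s, t, u]"
proof -
  have "finite S" using assms by (metis card.infinite zero_neq_numeral)
  then obtain xs where xs: "set xs = S" "distinct xs" using finite_distinct_list by blast
  then have "length xs = 6" using assms distinct_card by fastforce
  then obtain p q r s t u where "xs = [p, q, r, s, t, u]"
    by (auto simp: numeral_eq_Suc length_Suc_conv)
  then show thesis using that[of p q r s t u] xs by auto
qed

section \<open>Vertex orders that realise the three matrices\<close>

context matched_srsg
begin

lemma inj_m: "inj_on m X"
  by (rule inj_on_inverseI[where g = m]) (rule m_m)

lemma distinct_doubled:
  assumes "set xs \<subseteq> X" "distinct xs" "set xs \<inter> m ` set xs = {}"
  shows "distinct (xs @ map m xs)"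
  using assms inj_on_subset[OF inj_m] by (simp add: distinct_map)

lemma A_m: "u \<in> X \<Longrightarrow> v \<in> X \<Longrightarrow> A (m u) v = A u (m v)"
  "u \<in> X \<Longrightarrow> v \<in> X \<Longrightarrow> A (m u) (m v) = A u v"
proof -
  show *: "A (m u) v = A u (m v)" if "u \<in> X" "v \<in> X" for u v
    using that P_left_m m_m m_in by (simp add: A_def) metis
  show "A (m u) (m v) = A u v" if "u \<in> X" "v \<in> X" for u v
    using that * m_m m_in by metis
qed

text \<open>Any order of \<open>S\<close> followed by its image under \<open>m\<close> works, since
  the entries depend only on whether the two underlying vertices of \<open>S\<close> are
  equal.\<close>

lemma adj_rows_complete_bipartite:
  assumes "a = 0"
  shows "\<exists>xs. set xs = X \<and> distinct xs \<and> adj_rows xs A = rows1"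
proof -
  obtain S where S: "card S = 6" "X = S \<union> m ` S" "S \<inter> m ` S = {}"
    "\<And>x y. x \<in> S \<Longrightarrow> y \<in> S \<Longrightarrow> \<not> P x y \<and> (P x (m y) \<longleftrightarrow> x \<noteq> y)"
    using complete_bipartite_case[OF assms] by blast
  obtain p q r s t u where xs: "S = {p, q, r, s, t, u}" "distinct [p, q, r, s, t, u]"
    using card_six_obtain[OF S(1)] by blast
  let ?xs = "[p, q, r, s, t, u]"
  have A: "A x y = 0" "A x (m y) = (if x = y then -1 else 1)"
    "A (m x) y = (if x = y then -1 else 1)" "A (m x) (m y) = 0" if "x \<in> S" "y \<in> S" for x y
  proof -
    have xy: "x \<in> X" "y \<in> X" "y \<noteq> m x" using that S(2,3) by blast+
    then show 0: "A x y = 0" and 1: "A x (m y) = (if x = y then -1 else 1)"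
      using S(4)[OF that] inj_m by (auto simp: A_def inj_on_eq_iff)
    then show "A (m x) y = (if x = y then -1 else 1)" "A (m x) (m y) = 0"
      using xy A_m by simp_all
  qed
  have "adj_rows (?xs @ map m ?xs) A = rows1"
    \<comment> \<open>Distinctness of the reversed list supplies every inequality in the other
      orientation.\<close>
    using xs(2) xs(2)[THEN distinct_rev[THEN iffD2]] A[unfolded xs(1)] by (simp add: adj_rows_def rows1_def)
  moreover have "distinct (?xs @ map m ?xs)"
    using S(2,3) xs by (intro distinct_doubled) auto
  moreover have "set (?xs @ map m ?xs) = X" using S(2) xs(1) by auto
  ultimately show ?thesis by blast
qed

lemma adj_rows_two_cliques:
  assumes "a = 4"
  shows "\<exists>xs. set xs = X \<and> distinct xs \<and> adj_rows xs A = rows2"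
proof -
  obtain S where S: "card S = 6" "X = S \<union> m ` S" "S \<inter> m ` S = {}"
    "\<And>x y. x \<in> S \<Longrightarrow> y \<in> S \<Longrightarrow> (P x y \<longleftrightarrow> x \<noteq> y) \<and> \<not> P x (m y)"
    using two_cliques_case[OF assms] by blast
  obtain p q r s t u where xs: "S = {p, q, r, s, t, u}" "distinct [p, q, r, s, t, u]"
    using card_six_obtain[OF S(1)] by blast
  let ?xs = "[p, q, r, s, t, u]"
  have A: "A x y = (if x = y then 0 else 1)" "A x (m y) = (if x = y then -1 else 0)"
    "A (m x) y = (if x = y then -1 else 0)" "A (m x) (m y) = (if x = y then 0 else 1)"
    if "x \<in> S" "y \<in> S" for x y
  proof -
    have xy: "x \<in> X" "y \<in> X" "y \<noteq> m x" using that S(2,3) by blast+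
    then show 0: "A x y = (if x = y then 0 else 1)" and 1: "A x (m y) = (if x = y then -1 else 0)"
      using S(4)[OF that] inj_m by (auto simp: A_def inj_on_eq_iff)
    then show "A (m x) y = (if x = y then -1 else 0)" "A (m x) (m y) = (if x = y then 0 else 1)"
      using xy A_m by simp_all
  qed
  have "adj_rows (?xs @ map m ?xs) A = rows2"
    using xs(2) xs(2)[THEN distinct_rev[THEN iffD2]] A[unfolded xs(1)] by (simp add: adj_rows_def rows2_def)
  moreover have "distinct (?xs @ map m ?xs)"
    using S(2,3) xs by (intro distinct_doubled) auto
  moreover have "set (?xs @ map m ?xs) = X" using S(2) xs(1) by auto
  ultimately show ?thesis by blast
qed

text \<open>The order must be \<open>v\<close>, \<open>m v\<close>, the pentagon in cyclic order and
  its image, so as to match \<open>rows3\<close>.\<close>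

lemma adj_rows_icosahedron:
  assumes "a = 2"
  shows "\<exists>xs. set xs = X \<and> distinct xs \<and> adj_rows xs A = rows3"
proof -
  obtain v x y p q z where
    X: "X = {v, m v} \<union> {x, y, p, q, z} \<union> m ` {x, y, p, q, z}" "card X = 12"
    and S: "N v = {x, y, p, q, z}" "distinct [x, y, p, q, z]"
    and D': "N x \<inter> N v = {z, y}" "N y \<inter> N v = {x, p}" "N p \<inter> N v = {y, q}"
      "N q \<inter> N v = {p, z}" "N z \<inter> N v = {q, x}"
    and opp: "\<And>s t. s \<in> N v \<Longrightarrow> t \<in> N v \<Longrightarrow> P s (m t) \<longleftrightarrow> s \<noteq> t \<and> \<not> P s t"
    by (rule icosahedron_case[OF assms]) blast
  define D where "D s = N s \<inter> N v" for s
  have D: "D x = {z, y}" "D y = {x, p}" "D p = {y, q}" "D q = {p, z}" "D z = {q, x}"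
    using D' by (simp_all add: D_def)
  have v: "v \<in> X" using X(1) by blast
  have Nv: "x \<in> N v" "y \<in> N v" "p \<in> N v" "q \<in> N v" "z \<in> N v" using S(1) by auto
  have Av: "A v v = 0" "A v (m v) = -1" "A (m v) v = -1" "A (m v) (m v) = 0"
    using v m_ne[OF v] not_P_m A_m[of v v] by (auto simp: A_def)
  have Avs: "A v s = 1" "A v (m s) = 0" "A (m v) s = 0" "A (m v) (m s) = 1"
    "A s v = 1" "A s (m v) = 0" "A (m s) v = 0" "A (m s) (m v) = 1" if s: "s \<in> N v" for s
  proof -
    have sX: "s \<in> X" "s \<noteq> v" "m s \<in> X" "m v \<in> X" using nbr_facts[OF s] m_in v by auto
    have "s \<notin> N (m v)" "s \<noteq> m v" using N_disjoint[OF v] s not_P_m in_N by blast+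
    then show 1: "A v s = 1" and 2: "A (m v) s = 0"
      using s in_N sX m_m[OF v] by (auto simp: A_def)
    show 3: "A v (m s) = 0" and 4: "A (m v) (m s) = 1"
      using 1 2 A_m[of v s] v sX by simp_all
    show "A s v = 1" "A s (m v) = 0" "A (m s) v = 0" "A (m s) (m v) = 1"
      using 1 2 3 4 A_commute v sX by metis+
  qed
  have As: "A s t = of_bool (t \<in> D s)" "A s (m t) = (if s = t then -1 else of_bool (t \<notin> D s))"
    "A (m s) t = (if s = t then -1 else of_bool (t \<notin> D s))" "A (m s) (m t) = of_bool (t \<in> D s)"
    if s: "s \<in> N v" and t: "t \<in> N v" for s t
  proof -
    have st: "s \<in> X" "t \<in> X" using s t N_sub by blast+
    have "m s \<notin> N v" using N_disjoint[OF v] N_m[OF v] s by blast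
    then have "t \<noteq> m s" using t by blast
    moreover have "P s t \<longleftrightarrow> t \<in> D s" using t by (simp add: D_def in_N)
    ultimately show 1: "A s t = of_bool (t \<in> D s)"
      and 2: "A s (m t) = (if s = t then -1 else of_bool (t \<notin> D s))"
      using opp[OF s t] inj_m st by (auto simp: A_def inj_on_eq_iff)
    then show "A (m s) t = (if s = t then -1 else of_bool (t \<notin> D s))"
      "A (m s) (m t) = of_bool (t \<in> D s)"
      using st A_m by simp_all
  qed
  let ?xs = "[v, m v] @ [x, y, p, q, z] @ map m [x, y, p, q, z]"
  have "adj_rows ?xs A = rows3"
    using S(2) S(2)[THEN distinct_rev[THEN iffD2]] by (simp add: adj_rows_def rows3_def Av Avs As Nv D)
  moreover have set: "set ?xs = X" using X(1) by auto
  moreover have "distinct ?xs" by (rule card_distinct) (use set X(2) in simp)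
  ultimately show ?thesis by blast
qed

end

text \<open>The graph is an instance of \<open>matched_srsg\<close>; in each case for
  \<open>a\<close> it has a vertex order with the same matrix as one of the three graphs.\<close>

lemma classification:
  assumes G: "signed_graph G" and conn: "sg_connected G"
    and reg: "sg_regular G 6 \<and> sg_net_regular G 4" and "srsg G"
  shows "sg_iso G S12_1 \<or> sg_iso G S12_2 \<or> sg_iso G S12_3"
proof -
  let ?X = "sg_verts G"
  obtain n r a b c where params: "srsg_params G n r a b c"
    using \<open>srsg G\<close> unfolding srsg_def by blast
  have fin: "finite ?X" using G by (simp add: signed_graph_def)
  have deg: "card {u \<in> ?X. pos_adj G v u} = 5" "card {u \<in> ?X. neg_adj G v u} = 1" if "v \<in> ?X" for v
    using that reg pos5_neg1_iff[OF G] by blast+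
  \<comment> \<open>The description is proper on the vertex set, where the negative degree is
    one.\<close>
  define m where "m v = (THE u. neg_adj G v u)" for v
  have m: "neg_adj G v u \<longleftrightarrow> u = m v" if v: "v \<in> ?X" for u v
  proof -
    obtain w where w: "{u \<in> ?X. neg_adj G v u} = {w}"
      using deg(2)[OF v] by (metis card_1_singletonE)
    have nw: "neg_adj G v u \<longleftrightarrow> u = w" for u
      using w neg_adj_in_verts[OF G, of v u] by blast
    then have "m v = w" by (simp add: m_def)
    with nw show ?thesis by simp
  qed
  have neg_m: "neg_adj G v (m v)" if "v \<in> ?X" for v using m[OF that] by simp
  have mX: "m v \<in> ?X" "m v \<noteq> v" if "v \<in> ?X" for v
    using neg_adj_in_verts[OF G neg_m[OF that]] by auto
  have mm: "m (m v) = v" if "v \<in> ?X" for v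
    using m[OF mX(1)[OF that], of v] neg_m[OF that] neg_adj_commute by metis
  have adj: "sg_adj_mat G u w = of_bool (pos_adj G u w) - of_bool (w = m u)" if "u \<in> ?X" for u w
    using m[OF that, of w] by (simp add: sg_adj_mat_eq[OF G])
  have sq: "sg_adj_mat_sq G u v = (\<Sum>w\<in>?X. (of_bool (pos_adj G u w) - of_bool (w = m u)) *
      (of_bool (pos_adj G w v) - of_bool (v = m w)))" if "u \<in> ?X" for u v
    unfolding sg_adj_mat_sq_def using adj that by (intro sum.cong refl) simp
  \<comment> \<open>The diagonal of the square counts the edges at a vertex.\<close>
  have "int r = 6"
  proof -
    obtain u where u: "u \<in> ?X" using conn by (auto simp: sg_connected_def)
    have "int r = sg_adj_mat_sq G u u"
      using params u unfolding srsg_params_def by simp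
    also have "\<dots> = (\<Sum>w\<in>?X. of_bool (pos_adj G u w) + of_bool (neg_adj G u w))"
      unfolding sg_adj_mat_sq_def
    proof (rule sum.cong[OF refl])
      fix w
      show "sg_adj_mat G u w * sg_adj_mat G w u = of_bool (pos_adj G u w) + of_bool (neg_adj G u w)"
        using not_pos_neg_adj[of G u w] pos_adj_commute[of G w u] neg_adj_commute[of G w u]
        by (simp add: sg_adj_mat_eq[OF G])
    qed
    also have "\<dots> = 6"
      using deg[OF u] fin by (simp add: sum.distrib sum_of_bool_eq Int_def)
    finally show ?thesis .
  qed
  interpret matched_srsg ?X "pos_adj G" m a b c
  proof
    show "finite ?X" by (fact fin)
    show "?X \<noteq> {}" using conn by (simp add: sg_connected_def)
    show "u \<in> ?X \<and> v \<in> ?X \<and> u \<noteq> v" if "pos_adj G u v" for u v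
      using pos_adj_in_verts[OF G that] .
    show "pos_adj G v u" if "pos_adj G u v" for u v
      using that pos_adj_commute by metis
    show "m v \<in> ?X" "m (m v) = v" "m v \<noteq> v" "card {u \<in> ?X. pos_adj G v u} = 5" if "v \<in> ?X" for v
      using that mX mm deg by auto
    \<comment> \<open>Outside the vertex set the value of \<open>m\<close> is arbitrary, but no
      positive edge starts there.\<close>
    show "\<not> pos_adj G v (m v)" for v
      using not_pos_neg_adj[of G v "m v"] neg_m[of v] pos_adj_in_verts[OF G, of v "m v"] by blast
    show "(\<Sum>w\<in>?X. (of_bool (pos_adj G u w) - of_bool (w = m u)) *
        (of_bool (pos_adj G w v) - of_bool (v = m w))) =
      (if u = v then 6 else if pos_adj G u v then a else if v = m u then b else c)"
      if uv: "u \<in> ?X" "v \<in> ?X" for u v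
    proof -
      have "sg_adj_mat_sq G u v =
          (if u = v then int r else if pos_adj G u v then a else if neg_adj G u v then b else c)"
        using params uv unfolding srsg_params_iff[OF G] by blast
      then show ?thesis unfolding sq[OF uv(1)] m[OF uv(1)] \<open>int r = 6\<close> .
    qed
    show "S = ?X" if S: "S \<subseteq> ?X" "S \<noteq> {}"
      and cl: "\<And>u v. u \<in> S \<Longrightarrow> pos_adj G u v \<Longrightarrow> v \<in> S" "\<And>u. u \<in> S \<Longrightarrow> m u \<in> S" for S
    proof -
      obtain s where s: "s \<in> S" using S(2) by blast
      have "v \<in> S" if "v \<in> ?X" for v
      proof -
        have "(s, v) \<in> {(x, y). {x, y} \<in> sg_edges G}\<^sup>*"
          using conn s S(1) that unfolding sg_connected_def by blast
        then show ?thesis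
        proof (induction rule: rtrancl_induct)
          case (step y z)
          then have "pos_adj G y z \<or> z = m y"
            using edge_iff_pos_or_neg[OF G, of y z] m[of y z] S(1) by blast
          then show ?case using cl step.IH by blast
        qed (fact s)
      qed
      then show ?thesis using S(1) by blast
    qed
  qed
  have A: "adj_rows xs (sg_adj_mat G) = adj_rows xs A" if "set xs = ?X" for xs
    using that by (simp add: adj_rows_def A_def adj)
  \<comment> \<open>The vertex type of \<open>H\<close> is left open because it is instantiated with
    both \<open>uw\<close> and \<open>nat\<close>.\<close>
  have iso: "sg_iso G H"
    if xs: "set xs = ?X" "distinct xs" "adj_rows xs A = R"
      and H: "signed_graph H" "sg_verts H = set ws" "distinct ws" "adj_rows ws f = R"
        "\<And>u v. u \<in> set ws \<Longrightarrow> v \<in> set ws \<Longrightarrow> sg_adj_mat H u v = f u v"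
    for xs R f ws and H :: "'w sgraph"
  proof (rule sg_iso_if_adj_rows_eq[OF G H(1) xs(1)[symmetric] xs(2) H(2,3)])
    have "adj_rows ws (sg_adj_mat H) = adj_rows ws f" using H(5) by (simp add: adj_rows_def)
    then show "adj_rows xs (sg_adj_mat G) = adj_rows ws (sg_adj_mat H)"
      using A[OF xs(1)] xs(3) H(4) by simp
  qed
  have dist: "distinct verts12" "distinct verts3" by (simp_all add: verts12_def verts3_def)
  from a_cases consider "a = 0" | "a = 2" | "a = 4" by blast
  then show ?thesis
  proof cases
    case 1
    then show ?thesis
      using adj_rows_complete_bipartite iso[OF _ _ _ signed_graph_S12_1 sg_verts_S12_1 dist(1)
          adj_rows_1 sg_adj_mat_S12_1] by blast
  next
    case 2
    then show ?thesis
      using adj_rows_icosahedron iso[OF _ _ _ signed_graph_S12_3 sg_verts_S12_3 dist(2)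
          adj_rows_3 sg_adj_mat_S12_3] by blast
  next
    case 3
    then show ?thesis
      using adj_rows_two_cliques iso[OF _ _ _ signed_graph_S12_2 sg_verts_S12_2 dist(1)
          adj_rows_2 sg_adj_mat_S12_2] by blast
  qed
qed

text \<open>The parameters of \<open>H\<close> pull back to \<open>G\<close>, where a positive edge
  exists and fixes \<open>a\<close>.\<close>

lemma sg_iso_imp_same_a:
  assumes "srsg_params G n r a b c" "srsg_params H n' r' a' b' c'"
    and "sg_regular G 6 \<and> sg_net_regular G 4" "sg_connected G" "sg_iso G H"
  shows "a = a'"
proof -
  have G: "signed_graph G" and H: "signed_graph H"
    using assms(1,2) by (simp_all add: srsg_params_def)
  obtain u where "u \<in> sg_verts G" using assms(4) by (auto simp: sg_connected_def)
  then have "card {v \<in> sg_verts G. pos_adj G u v} = 5"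
    using assms(3) pos5_neg1_iff[OF G] by blast
  then have "{v \<in> sg_verts G. pos_adj G u v} \<noteq> {}" by (metis card.empty zero_neq_numeral)
  then show ?thesis
    using srsg_params_pos_unique[OF assms(1) sg_iso_srsg_params[OF assms(5) G H assms(2)]] by blast
qed

lemma sg_iso_preserves:
  assumes "signed_graph G" "sg_iso G H" "sg_connected H \<and> sg_regular H 6 \<and> sg_net_regular H 4 \<and>
    srsg_params H n r a b c"
  shows "sg_connected G \<and> sg_regular G 6 \<and> srsg G \<and> sg_net_regular G 4"
proof -
  have H: "signed_graph H" using assms(3) by (simp add: srsg_params_def)
  show ?thesis
    using sg_iso_connected[OF assms(2,1) H] sg_iso_regularity[OF assms(2,1) H]
      sg_iso_srsg_params[OF assms(2,1) H] assms(3) unfolding srsg_def by blast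
qed

theorem theorem3p2:
  fixes G :: "'v sgraph"
  assumes "signed_graph G"
  shows "(sg_connected G \<and> sg_regular G 6 \<and> srsg G \<and> sg_net_regular G 4 \<longleftrightarrow>
            sg_iso G S12_1 \<or> sg_iso G S12_2 \<or> sg_iso G S12_3) \<and>
         \<not> sg_iso S12_1 S12_2 \<and> \<not> sg_iso S12_1 S12_3 \<and> \<not> sg_iso S12_2 S12_3 \<and>
         (sg_connected S12_1 \<and> sg_regular S12_1 6 \<and> sg_net_regular S12_1 4 \<and>
            srsg_params S12_1 12 6 0 0 2) \<and>
         (sg_connected S12_2 \<and> sg_regular S12_2 6 \<and> sg_net_regular S12_2 4 \<and>
            srsg_params S12_2 12 6 4 0 (-2)) \<and>
         (sg_connected S12_3 \<and> sg_regular S12_3 6 \<and> sg_net_regular S12_3 4 \<and>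
            srsg_params S12_3 12 6 2 0 0)"
proof -
  have "sg_iso G S12_1 \<or> sg_iso G S12_2 \<or> sg_iso G S12_3"
    if "sg_connected G \<and> sg_regular G 6 \<and> srsg G \<and> sg_net_regular G 4"
    using classification[OF assms] that by blast
  moreover have "sg_connected G \<and> sg_regular G 6 \<and> srsg G \<and> sg_net_regular G 4"
    if "sg_iso G S12_1 \<or> sg_iso G S12_2 \<or> sg_iso G S12_3"
    using that sg_iso_preserves[OF assms _ props_S12_1] sg_iso_preserves[OF assms _ props_S12_2]
      sg_iso_preserves[OF assms _ props_S12_3] by blast
  \<comment> \<open>The values 0, 4 and 2 of \<open>a\<close> are pairwise different.\<close>
  moreover have "\<not> sg_iso S12_1 S12_2" "\<not> sg_iso S12_1 S12_3" "\<not> sg_iso S12_2 S12_3"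
    using sg_iso_imp_same_a props_S12_1 props_S12_2 props_S12_3
    by (metis zero_neq_numeral, metis zero_neq_numeral, metis numeral_eq_iff num.distinct num.inject)
  ultimately show ?thesis using props_S12_1 props_S12_2 props_S12_3 by blast
qed

end
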